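(* Let $p$ be a prime and let $V$ be an $n$-dimensional finite vector space over the field of $p$ elements. The group $X = GL(1,p^{n}).n$ acts naturally on $V$. Then for any subgroup $G$ of $X$ we have $k(GV) \leq |V|$ unless $GV \cong D_{8}$ or $GV \cong S_4$.
   Context: For a finite group $Y$, $k(Y)$ denotes the number of conjugacy classes of $Y$. $GV$ denotes the semidirect product of $V$ with $G$. Here $V$ is identified with the field $\mathbb{F}_{p^n}$, and $GL(1,p^n).n$ is the group of order $n(p^n-1)$ generated by the multiplications by nonzero elements of $\mathbb{F}_{p^n}$ and the field automorphisms (Galois group of $\mathbb{F}_{p^n}$ over $\mathbb{F}_p$, cyclic of order $n$). $D_8$ is the dihedral group of order $8$ and $S_4$ is the symmetric group of degree $4$. *)

theory Defs
  imports "HOL-Algebra.Algebra"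
begin

definition semidirect_product ::
    "('v, 'm) monoid_scheme \<Rightarrow> ('g, 'n) monoid_scheme \<Rightarrow> ('g \<Rightarrow> 'v \<Rightarrow> 'v) \<Rightarrow> ('v \<times> 'g) monoid" where
  "semidirect_product N H \<phi> =
     \<lparr>carrier = carrier N \<times> carrier H,
      monoid.mult = (\<lambda>(v, g) (w, h). (v \<otimes>\<^bsub>N\<^esub> \<phi> g w, g \<otimes>\<^bsub>H\<^esub> h)),
      one = (\<one>\<^bsub>N\<^esub>, \<one>\<^bsub>H\<^esub>)\<rparr>"

lemma group_semidirect_product:
  assumes N: "group N" and H: "group H"
    and \<phi>: "\<And>g. g \<in> carrier H \<Longrightarrow> \<phi> g \<in> hom N N"
    and one: "\<And>v. v \<in> carrier N \<Longrightarrow> \<phi> \<one>\<^bsub>H\<^esub> v = v"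
    and mult: "\<And>g h v. \<lbrakk>g \<in> carrier H; h \<in> carrier H; v \<in> carrier N\<rbrakk>
                 \<Longrightarrow> \<phi> (g \<otimes>\<^bsub>H\<^esub> h) v = \<phi> g (\<phi> h v)"
  shows "group (semidirect_product N H \<phi>)"
proof -
  interpret N: group N by fact
  interpret H: group H by fact
  have closed: "\<phi> g v \<in> carrier N" if "g \<in> carrier H" "v \<in> carrier N" for g v
    using \<phi>[OF that(1)] that(2) by (auto simp: hom_def)
  have hom: "\<phi> g (v \<otimes>\<^bsub>N\<^esub> w) = \<phi> g v \<otimes>\<^bsub>N\<^esub> \<phi> g w"
    if "g \<in> carrier H" "v \<in> carrier N" "w \<in> carrier N" for g v w
    using \<phi>[OF that(1)] that by (auto simp: hom_def)
  show ?thesis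
  proof (rule groupI)
    fix x assume "x \<in> carrier (semidirect_product N H \<phi>)"
    then obtain v g where x: "x = (v, g)" "v \<in> carrier N" "g \<in> carrier H"
      by (auto simp: semidirect_product_def)
    let ?y = "(\<phi> (inv\<^bsub>H\<^esub> g) (inv\<^bsub>N\<^esub> v), inv\<^bsub>H\<^esub> g)"
    have "\<phi> (inv\<^bsub>H\<^esub> g) (inv\<^bsub>N\<^esub> v) \<otimes>\<^bsub>N\<^esub> \<phi> (inv\<^bsub>H\<^esub> g) v = \<phi> (inv\<^bsub>H\<^esub> g) \<one>\<^bsub>N\<^esub>"
      using x by (simp flip: hom)
    also have "\<dots> = \<one>\<^bsub>N\<^esub>"
      using hom_one[OF \<phi>[of "inv\<^bsub>H\<^esub> g"] N N] x by simp
    finally show "\<exists>y\<in>carrier (semidirect_product N H \<phi>).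
        y \<otimes>\<^bsub>semidirect_product N H \<phi>\<^esub> x = \<one>\<^bsub>semidirect_product N H \<phi>\<^esub>"
      using x closed by (intro bexI[of _ ?y]) (auto simp: semidirect_product_def)
  qed (auto simp: semidirect_product_def closed hom one mult N.m_assoc H.m_assoc)
qed

text \<open>
  The class number is the number of orbits of the conjugation action on the underlying set.
  Its value is the junk value 0 if there are infinitely many classes.
\<close>

definition class_number :: "('a, 'm) monoid_scheme \<Rightarrow> nat" where
  "class_number G =
     card (orbits G (carrier G) (\<lambda>g. \<lambda>h \<in> carrier G. g \<otimes>\<^bsub>G\<^esub> h \<otimes>\<^bsub>G\<^esub> inv\<^bsub>G\<^esub> g))"

text \<open>
  The library constant \<^const>\<open>BijGroup\<close> consists of extensional bijections, so multiplications and
  automorphisms are taken to be extensional on the carrier of the field.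
\<close>

definition field_mults :: "('a, 'm) ring_scheme \<Rightarrow> ('a \<Rightarrow> 'a) set" where
  "field_mults F = {\<lambda>x \<in> carrier F. a \<otimes>\<^bsub>F\<^esub> x | a. a \<in> carrier F - {\<zero>\<^bsub>F\<^esub>}}"

text \<open>
  Every ring automorphism of a field fixes the prime field pointwise, so for a finite field of
  characteristic \<open>p\<close> these automorphisms are the Galois group over the field with \<open>p\<close> elements.
\<close>

definition field_auts :: "('a, 'm) ring_scheme \<Rightarrow> ('a \<Rightarrow> 'a) set" where
  "field_auts F = ring_iso F F \<inter> extensional (carrier F)"

definition semilinear_group :: "('a, 'm) ring_scheme \<Rightarrow> ('a \<Rightarrow> 'a) monoid" where
  "semilinear_group F = subgroup_generated (BijGroup (carrier F)) (field_mults F \<union> field_auts F)"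

lemma semilinear_generators_subset:
  assumes "field F"
  shows "field_mults F \<union> field_auts F \<subseteq> carrier (BijGroup (carrier F))"
proof -
  interpret field F by fact
  have "bij_betw (\<lambda>x \<in> carrier F. a \<otimes>\<^bsub>F\<^esub> x) (carrier F) (carrier F)"
    if a: "a \<in> carrier F" "a \<noteq> \<zero>\<^bsub>F\<^esub>" for a
  proof (rule bij_betw_byWitness[where f' = "\<lambda>x. inv\<^bsub>F\<^esub> a \<otimes>\<^bsub>F\<^esub> x"])
    have u: "a \<in> Units F" using a by (simp add: field_Units)
    show "\<forall>x\<in>carrier F. inv\<^bsub>F\<^esub> a \<otimes>\<^bsub>F\<^esub> (\<lambda>x \<in> carrier F. a \<otimes>\<^bsub>F\<^esub> x) x = x"
      using u a by (simp flip: m_assoc)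
    show "\<forall>x\<in>carrier F. (\<lambda>x \<in> carrier F. a \<otimes>\<^bsub>F\<^esub> x) (inv\<^bsub>F\<^esub> a \<otimes>\<^bsub>F\<^esub> x) = x"
      using u a by (simp flip: m_assoc)
  qed (use a in \<open>auto simp: field_Units\<close>)
  then show ?thesis
    by (auto simp: field_mults_def field_auts_def BijGroup_def Bij_def ring_iso_def)
qed

lemma group_semilinear_group: "group (semilinear_group F)"
  unfolding semilinear_group_def
  by (intro group.group_subgroup_generated group_BijGroup)

lemma semilinear_group_one_apply: "v \<in> carrier F \<Longrightarrow> \<one>\<^bsub>semilinear_group F\<^esub> v = v"
  by (simp add: semilinear_group_def subgroup_generated_def BijGroup_def)

lemma semilinear_group_carrier_Bij: "carrier (semilinear_group F) \<subseteq> Bij (carrier F)"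
  using group.carrier_subgroup_generated_subset[OF group_BijGroup]
  by (auto simp: semilinear_group_def BijGroup_def)

lemma semilinear_group_mult_apply:
  assumes "g \<in> carrier (semilinear_group F)" "h \<in> carrier (semilinear_group F)" "v \<in> carrier F"
  shows "(g \<otimes>\<^bsub>semilinear_group F\<^esub> h) v = g (h v)"
proof -
  have "g \<in> Bij (carrier F)" "h \<in> Bij (carrier F)"
    using assms(1,2) semilinear_group_carrier_Bij by blast+
  then show ?thesis
    using assms(3) by (simp add: semilinear_group_def subgroup_generated_def BijGroup_def compose_def)
qed

lemma semilinear_group_additive:
  assumes "field F" "g \<in> carrier (semilinear_group F)"
  shows "g \<in> hom (add_monoid F) (add_monoid F)"
proof -
  interpret field F by fact
  let ?B = "BijGroup (carrier F)"
  let ?S = "field_mults F \<union> field_auts F"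
  have gen: "s \<in> hom (add_monoid F) (add_monoid F)" if "s \<in> ?S" for s
    using that by (auto simp: hom_def field_mults_def field_auts_def ring_iso_def ring_hom_def r_distr)
  have inv_hom: "inv\<^bsub>?B\<^esub> s \<in> hom (add_monoid F) (add_monoid F)"
    if s: "s \<in> Bij (carrier F)" "s \<in> hom (add_monoid F) (add_monoid F)" for s
  proof -
    have "s \<in> iso (add_monoid F) (add_monoid F)"
      using s by (auto simp: iso_def Bij_def)
    then have "inv_into (carrier F) s \<in> hom (add_monoid F) (add_monoid F)"
      using add.iso_set_sym[of s "add_monoid F"] by (auto simp: iso_def)
    then show ?thesis
      by (auto simp: inv_BijGroup[OF s(1)] hom_def)
  qed
  have "g \<in> generate ?B (carrier ?B \<inter> ?S)"
    using assms(2) by (simp add: semilinear_group_def carrier_subgroup_generated)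
  then have "g \<in> Bij (carrier F) \<and> g \<in> hom (add_monoid F) (add_monoid F)"
  proof (induction rule: generate.induct)
    case one
    have "\<one>\<^bsub>?B\<^esub> \<in> Bij (carrier F)" using id_Bij by (simp add: BijGroup_def)
    moreover have "\<one>\<^bsub>?B\<^esub> \<in> hom (add_monoid F) (add_monoid F)" by (simp add: BijGroup_def hom_def)
    ultimately show ?case by blast
  next
    case (incl h)
    then show ?case using gen by (auto simp: BijGroup_def)
  next
    case (inv h)
    then have h: "h \<in> Bij (carrier F)" "h \<in> ?S" by (auto simp: BijGroup_def)
    have "inv\<^bsub>?B\<^esub> h \<in> Bij (carrier F)"
      using group.inv_closed[OF group_BijGroup] h(1) by (force simp: BijGroup_def)
    then show ?case using gen[OF h(2)] inv_hom[OF h(1)] by blast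
  next
    case (eng h1 h2)
    then have "h1 \<otimes>\<^bsub>?B\<^esub> h2 = compose (carrier F) h1 h2"
      by (simp add: BijGroup_def)
    moreover have "compose (carrier F) h1 h2 \<in> hom (add_monoid F) (add_monoid F)"
      using eng by (auto simp: hom_def compose_def Pi_def)
    ultimately show ?case
      using eng by (simp add: compose_Bij)
  qed
  then show ?thesis by blast
qed

text \<open>
  The group \<open>GV\<close> for a group \<open>G\<close> of permutations of the field, acting on the additive group \<open>V\<close>
  of the field by evaluation.
\<close>

definition affine_product :: "('a, 'm) ring_scheme \<Rightarrow> ('a \<Rightarrow> 'a) set \<Rightarrow> ('a \<times> ('a \<Rightarrow> 'a)) monoid" where
  "affine_product F G =
     semidirect_product (add_monoid F) (semilinear_group F\<lparr>carrier := G\<rparr>) (\<lambda>g v. g v)"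

lemma group_affine_product:
  assumes F: "field F" and G: "subgroup G (semilinear_group F)"
  shows "group (affine_product F G)"
proof -
  interpret field F by fact
  have sub: "g \<in> carrier (semilinear_group F)" if "g \<in> G" for g
    using subgroup.subset[OF G] that by blast
  show ?thesis
    unfolding affine_product_def
  proof (rule group_semidirect_product)
    show "group (add_monoid F)" by (rule add.group_axioms)
    show "group (semilinear_group F\<lparr>carrier := G\<rparr>)"
      using group.subgroup_imp_group[OF group_semilinear_group G] .
  qed (simp_all add: semilinear_group_additive[OF F] sub semilinear_group_one_apply
        semilinear_group_mult_apply)
qed

text \<open>The dihedral group of order \<open>2 * n\<close>: the integers modulo \<open>n\<close> extended by negation.\<close>

definition dihedral_group :: "nat \<Rightarrow> (int \<times> int) monoid" where
  "dihedral_group n =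
     semidirect_product (integer_mod_group n) sign_img (\<lambda>e k. (e * k) mod int n)"

lemma group_dihedral_group: "group (dihedral_group n)"
  unfolding dihedral_group_def
proof (rule group_semidirect_product)
  show "(\<lambda>k. (e * k) mod int n) \<in> hom (integer_mod_group n) (integer_mod_group n)" for e
    by (auto simp: hom_def carrier_integer_mod_group mult_integer_mod_group mod_simps distrib_left)
  show "group sign_img" by (rule sign_img_is_group)
qed (auto simp: sign_img_def carrier_integer_mod_group mod_simps mult.assoc split: if_splits)

lemma card_dihedral_group: "card (carrier (dihedral_group n)) = 2 * n"
proof (cases "n = 0")
  case True
  then show ?thesis
    by (simp add: dihedral_group_def semidirect_product_def sign_img_def card_cartesian_product
        integer_mod_group_def integer_group_def)
next
  case False
  then show ?thesis
    by (simp add: dihedral_group_def semidirect_product_def sign_img_def card_cartesian_product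
        carrier_integer_mod_group)
qed

end

theory Submission
  imports Defs
begin

text \<open>
  Write \<open>q\<close> for the number of elements of the field \<open>V\<close>. Every element of \<open>G\<close> is a semilinear map
  \<open>x \<mapsto> a * s x\<close> with a nonzero scalar \<open>a\<close> and a field automorphism \<open>s\<close>. Let \<open>d\<close> be the number of
  automorphisms that occur, and \<open>m\<close> the number of scalars \<open>u\<close> for which multiplication by \<open>u\<close> lies
  in \<open>G\<close>; the elements of \<open>G\<close> over one automorphism form a coset of these multiplications, so \<open>G\<close> has
  order \<open>m * d\<close>.

  By Burnside's lemma the class number \<open>k\<close> of \<open>GV\<close> times the order \<open>q * m * d\<close> is the number of
  commuting pairs in \<open>GV\<close>. The pairs \<open>(v, g)\<close> and \<open>(w, h)\<close> commute iff \<open>g\<close> and \<open>h\<close> commute and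
  \<open>v - h v = w - g w\<close>. For a fixed \<open>g\<close> over \<open>s\<close> and all \<open>h\<close> over a fixed \<open>t\<close>, the number of solutions is
  at most \<open>q * (c + f)\<close>, where \<open>c\<close> counts the scalars of \<open>G\<close> fixed by \<open>s\<close> and \<open>f\<close> the nonzero fixed
  vectors of \<open>g\<close> (\<open>commuting_pairs_le\<close>). The sum over the \<open>g\<close> over \<open>s\<close> is bounded in terms of \<open>s\<close> alone.
  Since the count is symmetric in \<open>s\<close> and \<open>t\<close>, the bound of a nontrivial automorphism can be used
  for every pair \<open>(s, t)\<close> other than the pair of identities, which gives
  \<open>k * d * m \<le> m^2 + (q - 1) + (d + 1) * (\<Sum>s. m * min m x\<^sub>s + min (m * x\<^sub>s) (q - 1))\<close>.
  Here \<open>s\<close> runs over the nontrivial automorphisms that occur, and \<open>x\<^sub>s\<close> is the number of nonzero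
  elements that \<open>s\<close> fixes.

  The automorphisms that occur form a group, and all automorphisms of a finite field are powers of
  the Frobenius map. Hence the \<open>s\<close> are the powers of a single automorphism, \<open>q = r ^ d\<close> for some
  \<open>r \<ge> 2\<close>, and the \<open>i\<close>-th power fixes at most \<open>r ^ min i (d - i) - 1\<close> nonzero elements
  (\<open>automorphism_group_cyclic\<close>). These numbers are so small against \<open>r ^ d\<close> that the inequality forces
  \<open>k \<le> q\<close> unless \<open>r = d = 2\<close> (\<open>class_number_arithmetic\<close>). In the remaining case \<open>q = 4\<close>, the same
  inequality yields \<open>k \<le> 4\<close> for \<open>m = 2\<close>; for \<open>m = 1\<close> and \<open>m = 3\<close> the group \<open>GV\<close> has order 8 and 24,
  and is dihedral and the full symmetric group on \<open>V\<close>, respectively.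
\<close>

section \<open>Frobenius maps and automorphisms of a finite field\<close>

lemma (in cring) binomial_expansion:
  assumes x: "x \<in> carrier R" and y: "y \<in> carrier R"
  shows "(x \<oplus> y) [^] n = (\<Oplus>i\<in>{..n::nat}. add_pow R (n choose i) (x [^] i \<otimes> y [^] (n - i)))"
proof (induction n)
  case 0
  then show ?case using x y by simp
next
  case (Suc n)
  let ?T = "\<lambda>n i. add_pow R (n choose i) (x [^] i \<otimes> y [^] (n - i))"
  let ?A = "\<lambda>i. add_pow R (n choose i) (x [^] Suc i \<otimes> y [^] (n - i))"
  let ?B = "\<lambda>i. add_pow R (n choose i) (x [^] i \<otimes> y [^] (Suc n - i))"
  have cl: "?A \<in> S \<rightarrow> carrier R" "?B \<in> S \<rightarrow> carrier R" "?T k \<in> S \<rightarrow> carrier R" for S k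
    using x y by auto
  have x': "?T n i \<otimes> x = ?A i" for i
    using x y by (simp add: add_pow_ldistr add_pow_rdistr m_ac)
  have y': "?T n i \<otimes> y = ?B i" if "i \<le> n" for i
  proof -
    have "Suc n - i = Suc (n - i)" using that by simp
    then show ?thesis using x y by (simp add: add_pow_ldistr add_pow_rdistr m_ac)
  qed
  have "(x \<oplus> y) [^] Suc n = (\<Oplus>i\<in>{..n}. ?T n i) \<otimes> x \<oplus> (\<Oplus>i\<in>{..n}. ?T n i) \<otimes> y"
    using x y Suc.IH by (simp add: r_distr)
  also have "(\<Oplus>i\<in>{..n}. ?T n i) \<otimes> x = (\<Oplus>i\<in>{..n}. ?A i)"
    using cl x by (subst finsum_ldistr) (auto simp: x' intro!: finsum_cong')
  also have "(\<Oplus>i\<in>{..n}. ?T n i) \<otimes> y = (\<Oplus>i\<in>{..n}. ?B i)"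
    using cl x y by (subst finsum_ldistr) (auto simp: y' intro!: finsum_cong')
  also have "(\<Oplus>i\<in>{..n}. ?B i) = (\<Oplus>i\<in>{..Suc n}. ?B i)"
    using finsum_Suc[OF cl(2)[of "{..Suc n}"]] cl(2) by (simp add: finsum_closed binomial_eq_0)
  also have "\<dots> = (\<Oplus>i\<in>{..n}. ?B (Suc i)) \<oplus> ?B 0"
    by (rule finsum_Suc2[OF cl(2)])
  also have "(\<Oplus>i\<in>{..n}. ?A i) \<oplus> ((\<Oplus>i\<in>{..n}. ?B (Suc i)) \<oplus> ?B 0)
      = ((\<Oplus>i\<in>{..n}. ?A i) \<oplus> (\<Oplus>i\<in>{..n}. ?B (Suc i))) \<oplus> ?B 0"
    using x y cl(1) by (intro a_assoc[symmetric] finsum_closed) auto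
  also have "(\<Oplus>i\<in>{..n}. ?A i) \<oplus> (\<Oplus>i\<in>{..n}. ?B (Suc i))
      = (\<Oplus>i\<in>{..n}. ?A i \<oplus> ?B (Suc i))"
    using x y by (intro finsum_addf[symmetric]) auto
  also have "\<dots> = (\<Oplus>i\<in>{..n}. ?T (Suc n) (Suc i))"
    using x y by (intro finsum_cong') (auto simp: add.nat_pow_mult)
  also have "\<dots> \<oplus> ?B 0 = (\<Oplus>i\<in>{..Suc n}. ?T (Suc n) i)"
    using finsum_Suc2[OF cl(3)[of "Suc n" "{..Suc n}"]] by simp
  finally show ?case .
qed

lemma (in cring) add_pow_eq_zero:
  assumes "add_pow R p \<one> = \<zero>" "p dvd k" "z \<in> carrier R"
  shows "add_pow R (k::nat) z = \<zero>"
proof -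
  obtain l where k: "k = p * l" using assms(2) by blast
  have "add_pow R k z = (add_pow R k \<one>) \<otimes> z" using assms(3) by (simp add: add_pow_ldistr)
  also have "add_pow R k \<one> = add_pow R l (add_pow R p \<one>)" by (simp add: k add.nat_pow_pow)
  finally show ?thesis using assms by simp
qed

text \<open>
  The inner binomial coefficients are divisible by \<open>p\<close>, so only the two outer terms of the expansion
  survive.
\<close>

lemma (in cring) power_prime_add:
  assumes p: "Factorial_Ring.prime p" "add_pow R p \<one> = \<zero>" and x: "x \<in> carrier R" and y: "y \<in> carrier R"
  shows "(x \<oplus> y) [^] (p::nat) = x [^] p \<oplus> y [^] p"
proof -
  let ?T = "\<lambda>i. add_pow R (p choose i) (x [^] i \<otimes> y [^] (p - i))"
  have p0: "0 < p" using p(1) by (rule prime_gt_0_nat)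
  have mid: "?T i = \<zero>" if "i \<in> {1..<p}" for i
    using that x y by (intro add_pow_eq_zero[OF p(2)] dvd_choose_prime p(1)) auto
  have "{..p} = insert 0 (insert p {1..<p})" by auto
  then have "(\<Oplus>i\<in>{..p}. ?T i) = ?T 0 \<oplus> (?T p \<oplus> (\<Oplus>i\<in>{1..<p}. ?T i))"
    using p0 x y by (auto simp: finsum_insert finsum_closed)
  also have "(\<Oplus>i\<in>{1..<p}. ?T i) = (\<Oplus>i\<in>{1..<p}. \<zero>)"
    using mid by (intro finsum_cong') auto
  finally have "(x \<oplus> y) [^] p = y [^] p \<oplus> x [^] p"
    using x y by (simp add: binomial_expansion finsum_zero)
  then show ?thesis using x y by (simp add: a_comm)
qed

lemma (in cring) power_prime_power_add:
  assumes p: "Factorial_Ring.prime p" "add_pow R p \<one> = \<zero>" and x: "x \<in> carrier R" and y: "y \<in> carrier R"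
  shows "(x \<oplus> y) [^] ((p::nat) ^ j) = x [^] (p ^ j) \<oplus> y [^] (p ^ j)"
proof (induction j)
  case (Suc j)
  have "(x \<oplus> y) [^] (p ^ Suc j) = ((x \<oplus> y) [^] (p ^ j)) [^] p"
    using x y by (simp add: nat_pow_pow mult.commute)
  also have "\<dots> = x [^] (p ^ Suc j) \<oplus> y [^] (p ^ Suc j)"
    using x y Suc by (simp add: power_prime_add[OF p] nat_pow_pow mult.commute)
  finally show ?case .
qed (use x y in simp)

text \<open>
  Restricted to the carrier because the elements of \<open>field_auts\<close> are extensional.
\<close>

definition frobenius :: "('a, 'm) ring_scheme \<Rightarrow> nat \<Rightarrow> nat \<Rightarrow> 'a \<Rightarrow> 'a" where
  "frobenius R p j = (\<lambda>x\<in>carrier R. x [^]\<^bsub>R\<^esub> (p ^ j))"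

lemma (in field) frobenius_field_aut:
  assumes p: "Factorial_Ring.prime p" "add_pow R p \<one> = \<zero>" and fin: "finite (carrier R)"
  shows "frobenius R p j \<in> field_auts R"
proof -
  have hom: "frobenius R p j \<in> ring_hom R R"
    by (auto simp: ring_hom_def frobenius_def nat_pow_distrib power_prime_power_add[OF p])
  then have "inj_on (frobenius R p j) (carrier R)"
    by (rule non_trivial_field_hom_is_inj) (simp_all add: field_axioms)
  moreover have "frobenius R p j ` carrier R \<subseteq> carrier R" by (auto simp: frobenius_def)
  ultimately have "bij_betw (frobenius R p j) (carrier R) (carrier R)"
    using endo_inj_surj[OF fin] unfolding bij_betw_def by blast
  then show ?thesis using hom by (simp add: field_auts_def ring_iso_def frobenius_def)
qed

lemma (in domain) nat_pow_eq_zero: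
  "\<lbrakk>x \<in> carrier R; x [^] (n::nat) = \<zero>\<rbrakk> \<Longrightarrow> x = \<zero>"
proof (induction n)
  case (Suc n)
  then show ?case using integral[of "x [^] n" x] by auto
qed simp

lemma (in field) char_of_prime_power_card:
  assumes p: "Factorial_Ring.prime p" and card: "card (carrier R) = p ^ n" and fin: "finite (carrier R)"
  shows "add_pow R p \<one> = \<zero>"
proof -
  have mult: "add_pow R (k * l) \<one> = add_pow R k \<one> \<otimes> add_pow R l \<one>" for k l :: nat
    by (simp add: add_pow_ldistr add_pow_rdistr add.nat_pow_pow mult.commute)
  have pow: "add_pow R (p ^ k) \<one> = (add_pow R p \<one>) [^] k" for k
    by (induction k) (simp_all add: mult m_comm)
  have "add_pow R (p ^ n) \<one> = \<zero>"
    using add.pow_order_eq_1[of \<one>] card by (simp add: order_def)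
  then show ?thesis
    using nat_pow_eq_zero[of "add_pow R p \<one>" n] pow[of n] by simp
qed

text \<open>
  The root bound for polynomials, in terms of the coefficient function.
\<close>

lemma (in domain) polynomial_vanishing_coeffs:
  assumes fin: "finite (carrier R)" and c: "\<And>i. i < d \<Longrightarrow> c i \<in> carrier R"
    and S: "S \<subseteq> carrier R" "d \<le> card S"
    and zero: "\<And>x. x \<in> S \<Longrightarrow> (\<Oplus>i\<in>{..<d}. c i \<otimes> x [^] i) = \<zero>"
    and i: "i < d"
  shows "c i = \<zero>"
proof (rule ccontr)
  assume nz: "c i \<noteq> \<zero>"
  define f where "f = (\<lambda>n. if n < d then c n else \<zero>)"
  have "bound \<zero> d f" by (rule bound.intro) (simp add: f_def)
  then have "f \<in> up R" using c by (intro mem_upI) (auto simp: f_def)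
  then have f: "f \<in> carrier (UP R)" and coeff: "up_ring.coeff (UP R) f k = f k" for k
    by (simp_all add: UP_def)
  interpret UP: UP_domain R "UP R" by unfold_locales
  have "f i \<noteq> \<zero>" using i nz by (simp add: f_def)
  then have f0: "f \<noteq> \<zero>\<^bsub>UP R\<^esub>" using coeff[of i] UP.coeff_zero by metis
  have deg: "deg R f < d"
  proof -
    have "deg R f \<le> d - 1"
      by (rule UP.deg_aboveI[OF _ f]) (subst coeff, auto simp: f_def)
    then show ?thesis using i by simp
  qed
  have "UnivPoly.eval R R id x f = \<zero>" if x: "x \<in> S" for x
  proof -
    have xR: "x \<in> carrier R" using x S by blast
    have "UnivPoly.eval R R id x f = (\<Oplus>k\<in>{..deg R f}. f k \<otimes> x [^] k)"
      by (subst UP.eval_on_carrier[OF f]) (simp add: coeff)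
    also have "\<dots> = (\<Oplus>k\<in>{..<d}. f k \<otimes> x [^] k)"
    proof (rule add.finprod_mono_neutral_cong_left)
      show "f k \<otimes> x [^] k = \<zero>" if "k \<in> {..<d} - {..deg R f}" for k
        using that UP.deg_aboveD[OF _ f, of k] xR by (simp add: coeff)
    qed (use deg c xR in \<open>auto simp: f_def\<close>)
    also have "\<dots> = (\<Oplus>k\<in>{..<d}. c k \<otimes> x [^] k)"
      using c xR by (intro finsum_cong') (auto simp: f_def)
    finally show ?thesis using zero[OF x] by simp
  qed
  then have "S \<subseteq> {a \<in> carrier R. UnivPoly.eval R R id a f = \<zero>}" using S by auto
  then have "card S \<le> card {a \<in> carrier R. UnivPoly.eval R R id a f = \<zero>}"
    using fin by (intro card_mono) auto
  also have "\<dots> \<le> deg R f" using UP.roots_bound[OF f f0 fin] by blast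
  finally show False using deg S by simp
qed

context field
begin

lemma finite_field_auts:
  assumes "finite (carrier R)" shows "finite (field_auts R)"
proof (rule finite_subset)
  show "field_auts R \<subseteq> carrier R \<rightarrow>\<^sub>E carrier R"
    by (auto simp: field_auts_def ring_iso_def PiE_def ring_hom_def)
qed (use assms in \<open>simp add: finite_PiE\<close>)

lemma field_aut_ring_hom: "s \<in> field_auts R \<Longrightarrow> ring_hom_cring R R s"
  by (intro ring_hom_cring.intro ring_hom_cring_axioms.intro is_cring)
     (simp_all add: field_auts_def ring_iso_def)

text \<open>
  A generator of the multiplicative group determines an automorphism by its image.
\<close>

lemma field_aut_eqI:
  assumes gen: "carrier (Multiplicative_Group.mult_of R) = {a [^] i | i::nat. i \<in> UNIV}" "a \<in> carrier R"
    and auts: "s \<in> field_auts R" "t \<in> field_auts R" and eq: "s a = t a"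
  shows "s = t"
proof (rule extensionalityI[of _ "carrier R"])
  interpret hs: ring_hom_cring R R s by (rule field_aut_ring_hom[OF auts(1)])
  interpret ht: ring_hom_cring R R t by (rule field_aut_ring_hom[OF auts(2)])
  fix x assume x: "x \<in> carrier R"
  show "s x = t x"
  proof (cases "x = \<zero>")
    case False
    then have "x \<in> carrier (Multiplicative_Group.mult_of R)" using x by simp
    then obtain i :: nat where "x = a [^] i" using gen(1) by blast
    then show ?thesis using gen(2) eq by simp
  qed simp
qed (use auts in \<open>simp_all add: field_auts_def\<close>)

text \<open>
  A quantitative form of Artin's bound. Let \<open>a\<close> generate the multiplicative group and let \<open>d\<close> be the
  number of automorphisms. If there were more than \<open>q\<close> polynomials of degree below \<open>d\<close> with
  coefficients in \<open>K\<close>, two of them would agree at \<open>a\<close>, hence at the \<open>d\<close> distinct images of \<open>a\<close>: their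
  difference would have more roots than its degree allows.
\<close>

lemma card_fixed_power_card_auts_le:
  assumes fin: "finite (carrier R)" and A: "A \<subseteq> field_auts R"
    and K: "K \<subseteq> carrier R" and fixed: "\<And>s x. \<lbrakk>s \<in> A; x \<in> K\<rbrakk> \<Longrightarrow> s x = x"
  shows "card K ^ card A \<le> card (carrier R)"
proof (rule ccontr)
  assume big: "\<not> ?thesis"
  obtain a where a: "a \<in> carrier (Multiplicative_Group.mult_of R)"
    and gen: "carrier (Multiplicative_Group.mult_of R) = {a [^] i | i::nat. i \<in> UNIV}"
    using finite_field_mult_group_has_gen[OF fin] by blast
  have aR: "a \<in> carrier R" using a by simp
  define d where "d = card A"
  let ?ev = "\<lambda>c. \<Oplus>i\<in>{..<d}. c i \<otimes> a [^] i"
  have evR: "?ev c \<in> carrier R" if "c \<in> {..<d} \<rightarrow>\<^sub>E K" for c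
    using that K aR by (intro finsum_closed) auto
  have "card (carrier R) < card ({..<d} \<rightarrow>\<^sub>E K)"
    using big by (simp add: card_PiE d_def)
  moreover have "?ev ` ({..<d} \<rightarrow>\<^sub>E K) \<subseteq> carrier R" using evR by blast
  ultimately have "\<not> inj_on ?ev ({..<d} \<rightarrow>\<^sub>E K)"
    using card_inj_on_le[OF _ _ fin] by fastforce
  then obtain c c' where c: "c \<in> {..<d} \<rightarrow>\<^sub>E K" and c': "c' \<in> {..<d} \<rightarrow>\<^sub>E K"
    and neq: "c \<noteq> c'" and eq: "?ev c = ?ev c'"
    unfolding inj_on_def by blast
  have image: "s (?ev b) = (\<Oplus>i\<in>{..<d}. b i \<otimes> s a [^] i)"
    if s: "s \<in> A" and b: "b \<in> {..<d} \<rightarrow>\<^sub>E K" for s b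
  proof -
    interpret ring_hom_cring R R s using s A by (intro field_aut_ring_hom) auto
    have bR: "b i \<in> carrier R" "s (b i) = b i" if "i < d" for i
      using that b K fixed[OF s] by auto
    have "s (?ev b) = (\<Oplus>i\<in>{..<d}. s (b i \<otimes> a [^] i))"
      using bR aR by (subst hom_finsum) (auto simp: comp_def)
    also have "\<dots> = (\<Oplus>i\<in>{..<d}. b i \<otimes> s a [^] i)"
      using bR aR by (intro finsum_cong') auto
    finally show ?thesis .
  qed
  have "c i \<ominus> c' i = \<zero>" if i: "i < d" for i
  proof (rule polynomial_vanishing_coeffs[OF fin _ _ _ _ i, of "\<lambda>i. c i \<ominus> c' i" "(\<lambda>s. s a) ` A"])
    have "inj_on (\<lambda>s. s a) A"
      using field_aut_eqI[OF gen aR] A by (auto intro!: inj_onI)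
    then show "d \<le> card ((\<lambda>s. s a) ` A)" by (simp add: card_image d_def)
    have closed: "s a \<in> carrier R" if "s \<in> A" for s
      using that A aR by (auto simp: field_auts_def ring_iso_def ring_hom_def)
    then show "(\<lambda>s. s a) ` A \<subseteq> carrier R" by auto
    show "c i \<ominus> c' i \<in> carrier R" if "i < d" for i using that c c' K by auto
    fix x assume "x \<in> (\<lambda>s. s a) ` A"
    then obtain s where s: "s \<in> A" "x = s a" by blast
    have x: "x \<in> carrier R" using s closed by simp
    have cR: "c i \<in> carrier R" "c' i \<in> carrier R" if "i < d" for i using that c c' K by auto
    let ?S = "\<Oplus>i\<in>{..<d}. c' i \<otimes> x [^] i"
    have "(\<Oplus>i\<in>{..<d}. (c i \<ominus> c' i) \<otimes> x [^] i) \<oplus> (\<Oplus>i\<in>{..<d}. c' i \<otimes> x [^] i)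
        = (\<Oplus>i\<in>{..<d}. (c i \<ominus> c' i) \<otimes> x [^] i \<oplus> c' i \<otimes> x [^] i)"
      using cR x by (intro finsum_addf[symmetric]) auto
    also have "\<dots> = (\<Oplus>i\<in>{..<d}. c i \<otimes> x [^] i)"
    proof (rule finsum_cong')
      fix i assume "i \<in> {..<d}"
      then have "c i \<in> carrier R" "c' i \<in> carrier R" "x [^] i \<in> carrier R" using cR x by auto
      then show "(c i \<ominus> c' i) \<otimes> x [^] i \<oplus> c' i \<otimes> x [^] i = c i \<otimes> x [^] i" by algebra
    qed (use cR x in auto)
    also have "\<dots> = (\<Oplus>i\<in>{..<d}. c' i \<otimes> x [^] i)"
      using image[OF s(1) c] image[OF s(1) c'] eq s(2) by simp
    finally have "(\<Oplus>i\<in>{..<d}. (c i \<ominus> c' i) \<otimes> x [^] i) \<oplus> ?S = \<zero> \<oplus> ?S"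
      using cR x by (simp add: finsum_closed Pi_def)
    then show "(\<Oplus>i\<in>{..<d}. (c i \<ominus> c' i) \<otimes> x [^] i) = \<zero>"
      using cR x by (subst (asm) add.right_cancel) (auto intro!: finsum_closed)
  qed
  then have "c i = c' i" if "i < d" for i using that c c' K by (auto simp: PiE_iff subset_eq)
  then have "c = c'" using c c' by (intro PiE_ext) auto
  then show False using neq by simp
qed

text \<open>
  Every automorphism fixes the \<open>p\<close> multiples of the unit element, so the previous bound allows at most
  \<open>n\<close> automorphisms; the first \<open>n\<close> powers of the Frobenius map already are that many.
\<close>

lemma field_auts_eq_frobenius:
  assumes p: "Factorial_Ring.prime p" and card: "card (carrier R) = p ^ n" and fin: "finite (carrier R)"
  shows "field_auts R = frobenius R p ` {..<n}" "inj_on (frobenius R p) {..<n}"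
proof -
  have charp: "add_pow R p \<one> = \<zero>" by (rule char_of_prime_power_card[OF p card fin])
  have p1: "1 < p" using p by (rule prime_gt_1_nat)
  interpret M: group "Multiplicative_Group.mult_of R" by (rule field_mult_group)
  have finM: "finite (carrier (Multiplicative_Group.mult_of R))" using fin by simp
  obtain a where a: "a \<in> carrier (Multiplicative_Group.mult_of R)" and gen: "carrier (Multiplicative_Group.mult_of R) = {a [^] i | i::nat. i \<in> UNIV}"
    using finite_field_mult_group_has_gen[OF fin] by blast
  have "carrier (Multiplicative_Group.mult_of R) = (\<lambda>i. a [^] i) ` {0..M.ord a - 1}"
    using M.ord_elems[OF finM a] gen by (auto simp: Multiplicative_Group.nat_pow_mult_of)
  then have "card (carrier (Multiplicative_Group.mult_of R)) \<le> M.ord a - 1 + 1"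
    using card_image_le[of "{0..M.ord a - 1}" "\<lambda>i. a [^] i"] by simp
  then have ord: "p ^ n - 1 \<le> M.ord a"
    using M.ord_ge_1[OF finM a] order_mult_of[OF fin] card
    by (simp add: order_def)
  have aR: "a \<in> carrier R" using a by simp
  show inj: "inj_on (frobenius R p) {..<n}"
  proof (rule inj_onI)
    fix i j assume ij: "i \<in> {..<n}" "j \<in> {..<n}" and eq: "frobenius R p i = frobenius R p j"
    have "a [^] (p ^ i) = a [^] (p ^ j)"
      using fun_cong[OF eq, of a] aR by (simp add: frobenius_def)
    moreover have "p ^ k \<in> {1..M.ord a}" if "k < n" for k
    proof -
      have "p ^ k < p ^ n" using that p1 by simp
      moreover have "0 < p ^ k" using p1 by simp
      ultimately show ?thesis using ord unfolding atLeastAtMost_iff by linarith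
    qed
    ultimately have "p ^ i = p ^ j"
      using ij M.ord_inj'[OF a] by (auto simp: inj_on_def Multiplicative_Group.nat_pow_mult_of)
    then show "i = j" using p1 by simp
  qed
  define K where "K = (\<lambda>i. add_pow R i \<one>) ` {..<p}"
  have "card K = p"
  proof -
    have "add_pow R i \<one> \<noteq> add_pow R j \<one>" if ij: "i < j" "j < p" for i j
    proof
      assume "add_pow R i \<one> = add_pow R j \<one>"
      also have "\<dots> = add_pow R (j - i) \<one> \<oplus> add_pow R i \<one>"
        using ij by (simp add: add.nat_pow_mult)
      finally have z: "add_pow R (j - i) \<one> = \<zero>"
        by (simp add: add.l_cancel_one')
      \<comment> \<open>Both \<open>p\<close> and \<open>j - i\<close> annihilate the unit element and they are coprime, so 1 annihilates it, too.\<close>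
      have "coprime p (j - i)"
        using ij p by (intro prime_imp_coprime) (auto dest: dvd_imp_le)
      then obtain u v where uv: "(j - i) * u = p * v + 1"
        using bezout_nat[of "j - i" p] ij by (auto simp: gcd.commute coprime_iff_gcd_eq_1)
      have "add_pow R ((j - i) * u) \<one> = \<zero>" by (rule add_pow_eq_zero[OF z]) simp_all
      moreover have "add_pow R (p * v) \<one> = \<zero>" by (rule add_pow_eq_zero[OF charp]) simp_all
      ultimately show False using uv by simp
    qed
    then have "inj_on (\<lambda>i. add_pow R i \<one>) {..<p}"
      by (auto intro!: linorder_inj_onI)
    then show ?thesis by (simp add: K_def card_image)
  qed
  have "card K ^ card (field_auts R) \<le> card (carrier R)"
  proof (rule card_fixed_power_card_auts_le[OF fin])
    fix s x assume s: "s \<in> field_auts R" and x: "x \<in> K"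
    interpret ring_hom_cring R R s by (rule field_aut_ring_hom[OF s])
    have "s (add_pow R i \<one>) = add_pow R i \<one>" for i :: nat
      by (induction i) simp_all
    then show "s x = x" using x by (auto simp: K_def)
  qed (auto simp: K_def)
  then have "card (field_auts R) \<le> n"
    using \<open>card K = p\<close> card p1 by simp
  moreover have sub: "frobenius R p ` {..<n} \<subseteq> field_auts R"
    using frobenius_field_aut[OF p charp fin] by auto
  moreover have "card (frobenius R p ` {..<n}) = n" using inj by (simp add: card_image)
  ultimately show "field_auts R = frobenius R p ` {..<n}"
    using finite_field_auts[OF fin] by (metis card_seteq)
qed

lemma power_card_eq_self:
  assumes fin: "finite (carrier R)" and x: "x \<in> carrier R"
  shows "x [^] card (carrier R) = x"
proof (cases "x = \<zero>")
  case True
  have "card (carrier R) \<noteq> 0" using fin x by auto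
  then show ?thesis using True by (simp add: nat_pow_zero)
next
  case False
  interpret M: group "Multiplicative_Group.mult_of R" by (rule field_mult_group)
  have "x [^] (card (carrier R) - 1) = \<one>"
    using M.pow_order_eq_1[of x] x False order_mult_of[OF fin]
    by (simp add: Multiplicative_Group.nat_pow_mult_of order_def)
  moreover obtain k where "card (carrier R) = Suc k"
    using fin x by (cases "card (carrier R)") auto
  ultimately show ?thesis using x by simp
qed

lemma frobenius_compose:
  "compose (carrier R) (frobenius R p i) (frobenius R p j) = frobenius R p (i + j)"
  by (rule ext) (simp add: compose_def frobenius_def restrict_def nat_pow_pow power_add
        mult.commute[of "p ^ j"])

lemma frobenius_periodic:
  assumes "card (carrier R) = p ^ n" "finite (carrier R)"
  shows "frobenius R p (i + k * n) = frobenius R p i"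
proof (induction k)
  case (Suc k)
  have "frobenius R p (j + n) = frobenius R p j" for j
    using power_card_eq_self[OF assms(2)] assms(1)
    by (auto simp: frobenius_def power_add nat_pow_pow[symmetric] intro!: restrict_ext)
  from this[of "i + k * n"] Suc show ?case by (simp add: algebra_simps)
qed simp

text \<open>
  The nonzero fixed elements are roots of the polynomial \<open>X ^ (p ^ j - 1) - 1\<close>.
\<close>

lemma card_frobenius_fixed_le:
  assumes fin: "finite (carrier R)" and "1 < p" "0 < j"
  shows "card {x \<in> carrier R - {\<zero>}. frobenius R p j x = x} \<le> p ^ j - 1"
proof -
  have pj: "1 < p ^ j" using assms one_less_power by blast
  have "x [^] (p ^ j - 1) = \<one>"
    if x: "x \<in> carrier R" "x \<noteq> \<zero>" "frobenius R p j x = x" for x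
  proof -
    obtain k where k: "p ^ j = Suc k" using pj by (cases "p ^ j") auto
    have "x [^] k \<otimes> x = \<one> \<otimes> x" using x k by (simp add: frobenius_def)
    then show ?thesis using x k m_rcancel[of x "x [^] k" \<one>] by simp
  qed
  then have "{x \<in> carrier R - {\<zero>}. frobenius R p j x = x} \<subseteq> {x \<in> carrier R. x [^] (p ^ j - 1) = \<one>}"
    by auto
  then have "card {x \<in> carrier R - {\<zero>}. frobenius R p j x = x}
      \<le> card {x \<in> carrier R. x [^] (p ^ j - 1) = \<one>}"
    using fin by (intro card_mono) auto
  also have "\<dots> \<le> p ^ j - 1" using pj by (intro num_roots_le_deg fin) simp
  finally show ?thesis .
qed

text \<open>
  The exponents \<open>j\<close> for which the \<open>j\<close>-th Frobenius power lies in \<open>A\<close> are the multiples of a least one,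
  \<open>g\<close>, which divides \<open>n\<close>; then \<open>r = p ^ g\<close>. An element is fixed by the \<open>i\<close>-th power of the generator
  iff it is fixed by the inverse, which is the power with exponent \<open>card A - i\<close>. The smaller of the
  two exponents gives the better bound.
\<close>

lemma automorphism_group_cyclic:
  assumes p: "Factorial_Ring.prime p" and card: "card (carrier R) = p ^ n" and fin: "finite (carrier R)"
    and A: "A \<subseteq> field_auts R" "A \<noteq> {}"
    and closed: "\<And>s t. \<lbrakk>s \<in> A; t \<in> A\<rbrakk> \<Longrightarrow> compose (carrier R) s t \<in> A"
  obtains r \<psi> where "2 \<le> r" "r ^ card A = card (carrier R)" "1 \<le> card A"
    "bij_betw \<psi> {..<card A} A" "\<psi> 0 = (\<lambda>x\<in>carrier R. x)"
    "\<forall>i\<in>{1..<card A}.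
      card {x \<in> carrier R - {\<zero>}. \<psi> i x = x} \<le> r ^ min i (card A - i) - 1"
proof -
  let ?F = "frobenius R p"
  note auts = field_auts_eq_frobenius[OF p card fin]
  have p1: "1 < p" using p by (rule prime_gt_1_nat)
  have "card {\<zero>, \<one>} \<le> card (carrier R)" using fin by (intro card_mono) auto
  then have n1: "1 \<le> n" using card by (cases n) auto
  define J where "J = {j. ?F j \<in> A}"
  have in_J_iff: "?F j \<in> A \<longleftrightarrow> j \<in> J" for j by (simp add: J_def)
  have per: "?F (i + k * n) = ?F i" for i k by (rule frobenius_periodic[OF card fin])
  have add: "i + j \<in> J" if "i \<in> J" "j \<in> J" for i j
    using that closed[of "?F i" "?F j"] by (simp add: J_def frobenius_compose)
  have mul: "k * j + i \<in> J" if "j \<in> J" "i \<in> J" for k j i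
  proof (induction k)
    case (Suc k)
    then show ?case using add[OF that(1) Suc] by (simp add: add.assoc)
  qed (use that in simp)
  obtain j0 where j0: "j0 \<in> J" using A auts(1) by (auto simp: J_def)
  have diff: "j - i \<in> J" if "i \<in> J" "j \<in> J" "i \<le> j" for i j
  proof -
    \<comment> \<open>Exponents only matter modulo \<open>n\<close>, so subtracting \<open>i\<close> is adding \<open>n - 1\<close> copies of it.\<close>
    have "(n - 1) * i + j = (j - i) + i * n" using that(3) n1 by (cases n) (auto simp: algebra_simps)
    moreover have "(n - 1) * i + j \<in> J" by (rule mul[OF that(1,2)])
    ultimately show ?thesis by (simp add: J_def per)
  qed
  have zero: "0 \<in> J" using diff[OF j0 j0] by simp
  have nJ: "n \<in> J" using zero per[of 0 1] by (simp add: J_def)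
  define g where "g = (LEAST j. j \<in> J \<and> 0 < j)"
  have g: "g \<in> J" "0 < g"
    using LeastI[of "\<lambda>j. j \<in> J \<and> 0 < j" n] nJ n1 by (auto simp: g_def)
  have dvd: "g dvd j" if "j \<in> J" for j
  proof (rule ccontr)
    assume "\<not> g dvd j"
    then have pos: "0 < j mod g" by (simp add: mod_greater_zero_iff_not_dvd)
    have "(j div g) * g \<in> J" using mul[OF g(1) zero, of "j div g"] by simp
    then have "j mod g \<in> J" using diff[OF _ that] by (simp add: minus_div_mult_eq_mod[symmetric])
    then have "(LEAST j. j \<in> J \<and> 0 < j) \<le> j mod g" using pos by (intro Least_le) simp
    then have "g \<le> j mod g" by (simp add: g_def)
    then show False using mod_less_divisor[OF g(2), of j] by simp
  qed
  have JF: "j \<in> J \<longleftrightarrow> g dvd j" for j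
  proof
    assume "g dvd j"
    then obtain k where "j = k * g" by (metis dvdE mult.commute)
    then show "j \<in> J" using mul[OF g(1) zero, of k] by simp
  qed (rule dvd)
  define d where "d = n div g"
  have n: "n = g * d" using dvd[OF nJ] by (simp add: d_def)
  have d1: "1 \<le> d" using n n1 by (cases d) auto
  let ?\<psi> = "\<lambda>i. ?F (g * i)"
  have inj: "inj_on ?\<psi> {..<d}"
  proof (rule inj_onI)
    fix i j assume ij: "i \<in> {..<d}" "j \<in> {..<d}" "?\<psi> i = ?\<psi> j"
    then have "g * i \<in> {..<n}" "g * j \<in> {..<n}" using g(2) by (auto simp: n)
    then have "g * i = g * j" using inj_onD[OF auts(2), of "g * i" "g * j"] ij(3) by simp
    then show "i = j" using g(2) by simp
  qed
  have img: "?\<psi> ` {..<d} = A"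
  proof
    show "?\<psi> ` {..<d} \<subseteq> A" using JF by (auto simp: in_J_iff)
    show "A \<subseteq> ?\<psi> ` {..<d}"
    proof
      fix s assume s: "s \<in> A"
      then obtain j where j: "j < n" "s = ?F j" using A auts(1) by auto
      then obtain i where i: "j = g * i" using s JF[of j] in_J_iff[of j] by auto
      then have "g * i < g * d" using j(1) n by simp
      then have "i < d" by simp
      then show "s \<in> ?\<psi> ` {..<d}" using j i by blast
    qed
  qed
  have cardA: "card A = d" using card_image[OF inj] img by simp
  have "2 ^ 1 \<le> p ^ 1" using p1 by simp
  also have "\<dots> \<le> p ^ g" using p1 g(2) by (intro power_increasing) auto
  finally have r2: "2 \<le> p ^ g" by simp
  have fixed: "card {x \<in> carrier R - {\<zero>}. ?\<psi> i x = x} \<le> (p ^ g) ^ min i (d - i) - 1"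
    if i: "i \<in> {1..<d}" for i
  proof (cases "i \<le> d - i")
    case True
    have "0 < g * i" using i g(2) by simp
    then show ?thesis
      using card_frobenius_fixed_le[OF fin p1] True by (simp add: min_def flip: power_mult)
  next
    case False
    \<comment> \<open>The exponents \<open>g * i\<close> and \<open>g * (d - i)\<close> add up to \<open>n\<close>, and the \<open>n\<close>-th power is the identity.\<close>
    have "?F (g * (d - i)) x = x" if x: "x \<in> carrier R" "?\<psi> i x = x" for x
    proof -
      have "?F (g * (d - i)) x = compose (carrier R) (?F (g * (d - i))) (?\<psi> i) x"
        using x by (simp add: compose_eq)
      also have "\<dots> = ?F n x"
        using i by (simp add: frobenius_compose n algebra_simps)
      also have "\<dots> = x" using per[of 0 1] x(1) by (simp add: frobenius_def)
      finally show ?thesis .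
    qed
    then have "card {x \<in> carrier R - {\<zero>}. ?\<psi> i x = x}
        \<le> card {x \<in> carrier R - {\<zero>}. ?F (g * (d - i)) x = x}"
      using fin by (intro card_mono) auto
    also have "\<dots> \<le> p ^ (g * (d - i)) - 1"
      using i g(2) by (intro card_frobenius_fixed_le fin p1) simp
    finally show ?thesis using False by (simp add: min_def flip: power_mult)
  qed
  show thesis
  proof (rule that[of "p ^ g" ?\<psi>])
    show "bij_betw ?\<psi> {..<card A} A" using inj img by (simp add: bij_betw_def cardA)
    show "?\<psi> 0 = (\<lambda>x\<in>carrier R. x)" by (auto simp: frobenius_def intro!: restrict_ext)
    show "(p ^ g) ^ card A = card (carrier R)" by (simp add: card cardA n power_mult)
  qed (use r2 d1 cardA fixed in simp_all)
qed

end

section \<open>Groups of semilinear maps\<close>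

definition semilinear_maps :: "('a, 'm) ring_scheme \<Rightarrow> ('a \<Rightarrow> 'a) set" where
  "semilinear_maps R =
     {\<lambda>x\<in>carrier R. a \<otimes>\<^bsub>R\<^esub> s x | a s. a \<in> carrier R - {\<zero>\<^bsub>R\<^esub>} \<and> s \<in> field_auts R}"

context field
begin

lemma field_aut_compose:
  assumes "s \<in> field_auts R" "t \<in> field_auts R"
  shows "compose (carrier R) s t \<in> field_auts R"
proof -
  interpret hs: ring_hom_cring R R s by (rule field_aut_ring_hom[OF assms(1)])
  interpret ht: ring_hom_cring R R t by (rule field_aut_ring_hom[OF assms(2)])
  have "bij_betw (compose (carrier R) s t) (carrier R) (carrier R)"
    using assms by (intro bij_betw_compose) (auto simp: field_auts_def ring_iso_def)
  moreover have "compose (carrier R) s t \<in> ring_hom R R"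
    by (simp add: ring_hom_def compose_eq Pi_iff)
  ultimately show ?thesis by (simp add: field_auts_def ring_iso_def)
qed

lemma field_aut_closed: "\<lbrakk>s \<in> field_auts R; x \<in> carrier R\<rbrakk> \<Longrightarrow> s x \<in> carrier R"
  using ring_hom_closed[of s R R x] by (simp add: field_auts_def ring_iso_def)

lemma field_aut_id: "(\<lambda>x\<in>carrier R. x) \<in> field_auts R"
  using bij_betw_id[of "carrier R", unfolded id_def]
  by (simp add: field_auts_def ring_iso_def ring_hom_def)

lemma field_aut_nonzero:
  assumes "s \<in> field_auts R" "x \<in> carrier R" "x \<noteq> \<zero>"
  shows "s x \<noteq> \<zero>"
proof -
  interpret ring_hom_cring R R s by (rule field_aut_ring_hom[OF assms(1)])
  have "inj_on s (carrier R)" using assms(1) by (simp add: field_auts_def ring_iso_def bij_betw_def)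
  then show ?thesis using assms(2,3) hom_zero by (metis inj_onD zero_closed)
qed

lemma semilinear_mapsE:
  assumes "g \<in> semilinear_maps R"
  obtains a s where "a \<in> carrier R" "a \<noteq> \<zero>" "s \<in> field_auts R" "g = (\<lambda>x\<in>carrier R. a \<otimes> s x)"
  using assms by (auto simp: semilinear_maps_def)

lemma semilinear_maps_compose:
  assumes a: "a \<in> carrier R" "s \<in> field_auts R" and b: "b \<in> carrier R" "t \<in> field_auts R"
  shows "compose (carrier R) (\<lambda>x\<in>carrier R. a \<otimes> s x) (\<lambda>x\<in>carrier R. b \<otimes> t x)
    = (\<lambda>x\<in>carrier R. (a \<otimes> s b) \<otimes> compose (carrier R) s t x)"
proof -
  interpret hs: ring_hom_cring R R s by (rule field_aut_ring_hom[OF a(2)])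
  interpret ht: ring_hom_cring R R t by (rule field_aut_ring_hom[OF b(2)])
  show ?thesis using a(1) b(1) by (auto simp: compose_def m_assoc intro!: restrict_ext)
qed

lemma semilinear_maps_inverse:
  assumes a: "a \<in> carrier R" "a \<noteq> \<zero>" and s: "s \<in> field_auts R"
  obtains b t where "b \<in> carrier R" "b \<noteq> \<zero>" "t \<in> field_auts R"
    "compose (carrier R) (\<lambda>x\<in>carrier R. b \<otimes> t x) (\<lambda>x\<in>carrier R. a \<otimes> s x) = (\<lambda>x\<in>carrier R. x)"
proof -
  define t where "t = (\<lambda>x\<in>carrier R. inv_into (carrier R) s x)"
  have bij: "bij_betw s (carrier R) (carrier R)" using s by (simp add: field_auts_def ring_iso_def)
  have "inv_into (carrier R) s \<in> ring_iso R R"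
    using s by (intro ring_iso_set_sym ring_axioms) (simp add: field_auts_def)
  then have "t \<in> ring_iso R R" by (rule ring_iso_restrict) (simp add: t_def)
  then have t: "t \<in> field_auts R" by (simp add: field_auts_def t_def)
  interpret ht: ring_hom_cring R R t by (rule field_aut_ring_hom[OF t])
  have sR: "s x \<in> carrier R" if "x \<in> carrier R" for x using bij that by (auto simp: bij_betw_def)
  have ts: "t (s x) = x" if "x \<in> carrier R" for x
    using bij sR that by (simp add: t_def bij_betw_def)
  have u: "t a \<in> Units R" using field_aut_nonzero[OF t a] a by (simp add: field_Units)
  show thesis
  proof (rule that[of "inv (t a)" t])
    show "compose (carrier R) (\<lambda>x\<in>carrier R. inv (t a) \<otimes> t x) (\<lambda>x\<in>carrier R. a \<otimes> s x)
      = (\<lambda>x\<in>carrier R. x)"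
      using u a sR ts by (auto simp: compose_def m_assoc[symmetric] intro!: restrict_ext)
    show "inv (t a) \<noteq> \<zero>" using u Units_inv_Units field_Units by auto
  qed (use u t in simp_all)
qed

lemma semilinear_maps_Bij: "semilinear_maps R \<subseteq> Bij (carrier R)"
proof
  fix g assume "g \<in> semilinear_maps R"
  then obtain a s where a: "a \<in> carrier R" "a \<noteq> \<zero>" and s: "s \<in> field_auts R"
    and g: "g = (\<lambda>x\<in>carrier R. a \<otimes> s x)" by (rule semilinear_mapsE)
  have "(\<lambda>x\<in>carrier R. a \<otimes> x) \<in> Bij (carrier R)" "s \<in> Bij (carrier R)"
    using semilinear_generators_subset[OF field_axioms] a s
    by (auto simp: field_mults_def BijGroup_def)
  then have "compose (carrier R) (\<lambda>x\<in>carrier R. a \<otimes> x) s \<in> Bij (carrier R)" by (rule compose_Bij)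
  moreover have "s x \<in> carrier R" if "x \<in> carrier R" for x
    using s that by (rule field_aut_closed)
  then have "compose (carrier R) (\<lambda>x\<in>carrier R. a \<otimes> x) s = g"
    unfolding g compose_def by (intro restrict_ext) simp
  ultimately show "g \<in> Bij (carrier R)" by simp
qed

text \<open>
  The maps of this form are closed under composition and inverses, and include the generators.
\<close>

lemma carrier_semilinear_group_subset: "carrier (semilinear_group R) \<subseteq> semilinear_maps R"
proof -
  let ?B = "BijGroup (carrier R)"
  interpret B: group ?B by (rule group_BijGroup)
  have sub: "subgroup (semilinear_maps R) ?B"
  proof (rule B.subgroupI)
    show "semilinear_maps R \<subseteq> carrier ?B"
      using semilinear_maps_Bij by (simp add: BijGroup_def)
    show "semilinear_maps R \<noteq> {}"
      using field_aut_id one_closed one_not_zero unfolding semilinear_maps_def by blast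
  next
    fix g assume g: "g \<in> semilinear_maps R"
    then obtain a s where as: "a \<in> carrier R" "a \<noteq> \<zero>" "s \<in> field_auts R"
      "g = (\<lambda>x\<in>carrier R. a \<otimes> s x)" by (rule semilinear_mapsE)
    then obtain b t where bt: "b \<in> carrier R" "b \<noteq> \<zero>" "t \<in> field_auts R"
      "compose (carrier R) (\<lambda>x\<in>carrier R. b \<otimes> t x) g = (\<lambda>x\<in>carrier R. x)"
      using semilinear_maps_inverse by metis
    let ?h = "\<lambda>x\<in>carrier R. b \<otimes> t x"
    have h: "?h \<in> semilinear_maps R" using bt by (auto simp: semilinear_maps_def)
    have "?h \<otimes>\<^bsub>?B\<^esub> g = \<one>\<^bsub>?B\<^esub>"
      using bt(4) h g semilinear_maps_Bij by (auto simp: BijGroup_def)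
    then have "inv\<^bsub>?B\<^esub> g = ?h"
      using h g semilinear_maps_Bij by (intro B.inv_equality) (auto simp: BijGroup_def)
    then show "inv\<^bsub>?B\<^esub> g \<in> semilinear_maps R" using h by simp
  next
    fix g h assume g: "g \<in> semilinear_maps R" and h: "h \<in> semilinear_maps R"
    obtain a s where as: "a \<in> carrier R" "a \<noteq> \<zero>" "s \<in> field_auts R"
      "g = (\<lambda>x\<in>carrier R. a \<otimes> s x)" using g by (rule semilinear_mapsE)
    obtain b t where bt: "b \<in> carrier R" "b \<noteq> \<zero>" "t \<in> field_auts R"
      "h = (\<lambda>x\<in>carrier R. b \<otimes> t x)" using h by (rule semilinear_mapsE)
    have sb: "s b \<in> carrier R" using as(3) bt(1) by (rule field_aut_closed)
    have "a \<otimes> s b \<noteq> \<zero>" using as bt sb field_aut_nonzero by (simp add: integral_iff)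
    then have "compose (carrier R) g h \<in> semilinear_maps R"
      using as bt sb field_aut_compose[OF as(3) bt(3)] semilinear_maps_compose[OF as(1,3) bt(1,3)]
      by (auto simp: semilinear_maps_def)
    then show "g \<otimes>\<^bsub>?B\<^esub> h \<in> semilinear_maps R"
      using g h semilinear_maps_Bij by (auto simp: BijGroup_def)
  qed
  have "field_mults R \<subseteq> semilinear_maps R"
  proof
    fix g assume "g \<in> field_mults R"
    then obtain a where a: "a \<in> carrier R - {\<zero>}" "g = (\<lambda>x\<in>carrier R. a \<otimes> x)"
      by (auto simp: field_mults_def)
    then have "g = (\<lambda>x\<in>carrier R. a \<otimes> (\<lambda>x\<in>carrier R. x) x)" by (auto intro!: restrict_ext)
    then show "g \<in> semilinear_maps R" using a(1) field_aut_id unfolding semilinear_maps_def by blast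
  qed
  moreover have "field_auts R \<subseteq> semilinear_maps R"
  proof
    fix s assume s: "s \<in> field_auts R"
    then have "s = (\<lambda>x\<in>carrier R. \<one> \<otimes> s x)"
      using field_aut_closed[OF s] by (intro extensionalityI[of _ "carrier R"]) (simp_all add: field_auts_def)
    then show "s \<in> semilinear_maps R" using s one_closed one_not_zero unfolding semilinear_maps_def by blast
  qed
  ultimately have "carrier ?B \<inter> (field_mults R \<union> field_auts R) \<subseteq> semilinear_maps R" by blast
  then have "generate ?B (carrier ?B \<inter> (field_mults R \<union> field_auts R)) \<subseteq> semilinear_maps R"
    using B.generate_subgroup_incl[OF _ sub] by blast
  then show ?thesis by (simp add: semilinear_group_def carrier_subgroup_generated)
qed

end

text \<open>
  Dividing by the value at the unit element recovers \<open>s\<close> from \<open>x \<mapsto> a * s x\<close>, because \<open>s\<close> maps the unit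
  element to itself.
\<close>

definition aut_part :: "('a, 'm) ring_scheme \<Rightarrow> ('a \<Rightarrow> 'a) \<Rightarrow> 'a \<Rightarrow> 'a" where
  "aut_part R g = (\<lambda>x\<in>carrier R. inv\<^bsub>R\<^esub> (g \<one>\<^bsub>R\<^esub>) \<otimes>\<^bsub>R\<^esub> g x)"

lemma (in field) aut_part_semilinear:
  assumes a: "a \<in> carrier R" "a \<noteq> \<zero>" and s: "s \<in> field_auts R"
  shows "aut_part R (\<lambda>x\<in>carrier R. a \<otimes> s x) = s"
proof (rule extensionalityI[of _ "carrier R"])
  interpret hs: ring_hom_cring R R s by (rule field_aut_ring_hom[OF s])
  fix x assume x: "x \<in> carrier R"
  have "a \<in> Units R" using a by (simp add: field_Units)
  then show "aut_part R (\<lambda>x\<in>carrier R. a \<otimes> s x) x = s x"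
    using x a by (simp add: aut_part_def m_assoc[symmetric])
qed (use s in \<open>simp_all add: field_auts_def aut_part_def\<close>)

locale semilinear_subgroup = field R for R :: "('a, 'm) ring_scheme" (structure) +
  fixes G :: "('a \<Rightarrow> 'a) set"
  assumes fin: "finite (carrier R)" and sub: "subgroup G (semilinear_group R)"
begin

abbreviation V where "V \<equiv> carrier R"
abbreviation \<alpha> where "\<alpha> \<equiv> aut_part R"

lemma G_semilinear: "g \<in> G \<Longrightarrow> g \<in> semilinear_maps R"
  using subgroup.subset[OF sub] carrier_semilinear_group_subset by blast

lemma G_form:
  assumes "g \<in> G"
  shows "\<alpha> g \<in> field_auts R" "g \<one> \<in> V" "g \<one> \<noteq> \<zero>" "g = (\<lambda>x\<in>V. g \<one> \<otimes> \<alpha> g x)"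
proof -
  obtain a s where a: "a \<in> V" "a \<noteq> \<zero>" and s: "s \<in> field_auts R" and g: "g = (\<lambda>x\<in>V. a \<otimes> s x)"
    using G_semilinear[OF assms] by (rule semilinear_mapsE)
  interpret hs: ring_hom_cring R R s by (rule field_aut_ring_hom[OF s])
  have "\<alpha> g = s" using aut_part_semilinear[OF a s] g by simp
  moreover have "g \<one> = a" using a by (simp add: g)
  ultimately show "\<alpha> g \<in> field_auts R" "g \<one> \<in> V" "g \<one> \<noteq> \<zero>" "g = (\<lambda>x\<in>V. g \<one> \<otimes> \<alpha> g x)"
    using a s g by simp_all
qed

lemma G_apply: "\<lbrakk>g \<in> G; x \<in> V\<rbrakk> \<Longrightarrow> g x = g \<one> \<otimes> \<alpha> g x"
  by (drule fun_cong[OF G_form(4), of g x]) simp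

lemma G_closed: "\<lbrakk>g \<in> G; x \<in> V\<rbrakk> \<Longrightarrow> g x \<in> V"
  by (subst G_apply) (simp_all add: G_form field_aut_closed)

lemma G_add: "\<lbrakk>g \<in> G; x \<in> V; y \<in> V\<rbrakk> \<Longrightarrow> g (x \<oplus> y) = g x \<oplus> g y"
  using semilinear_group_additive[OF field_axioms, of g] subgroup.subset[OF sub]
  by (auto simp: hom_def)

lemma G_zero: "g \<in> G \<Longrightarrow> g \<zero> = \<zero>"
  using G_add[of g \<zero> \<zero>] G_closed[of g \<zero>] by simp

lemma G_minus:
  assumes g: "g \<in> G" and x: "x \<in> V" and y: "y \<in> V"
  shows "g (x \<ominus> y) = g x \<ominus> g y"
proof -
  have "(x \<ominus> y) \<oplus> y = x" using x y by algebra
  then have "g (x \<ominus> y) \<oplus> g y = g x" using G_add[OF g, of "x \<ominus> y" y] x y by simp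
  moreover have "g (x \<ominus> y) \<in> V" "g x \<in> V" "g y \<in> V" using G_closed[OF g] x y by simp_all
  moreover from this have "g (x \<ominus> y) = (g (x \<ominus> y) \<oplus> g y) \<ominus> g y" by algebra
  ultimately show ?thesis by simp
qed

lemma G_Bij: "g \<in> G \<Longrightarrow> g \<in> Bij V"
  using G_semilinear semilinear_maps_Bij by blast

lemma G_ext: "\<lbrakk>g \<in> G; h \<in> G; \<And>x. x \<in> V \<Longrightarrow> g x = h x\<rbrakk> \<Longrightarrow> g = h"
  by (intro extensionalityI[of g V h] Bij_imp_extensional G_Bij)

lemma G_inj: "\<lbrakk>g \<in> G; x \<in> V; y \<in> V; g x = g y\<rbrakk> \<Longrightarrow> x = y"
  using G_Bij[of g] by (auto simp: Bij_def bij_betw_def dest: inj_onD)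

lemma mult_eq_compose: "\<lbrakk>g \<in> G; h \<in> G\<rbrakk> \<Longrightarrow> g \<otimes>\<^bsub>semilinear_group R\<^esub> h = compose V g h"
  using G_Bij by (simp add: semilinear_group_def subgroup_generated_def BijGroup_def)

lemma one_eq_id: "\<one>\<^bsub>semilinear_group R\<^esub> = (\<lambda>x\<in>V. x)"
  by (simp add: semilinear_group_def subgroup_generated_def BijGroup_def)

lemma compose_in_G: "\<lbrakk>g \<in> G; h \<in> G\<rbrakk> \<Longrightarrow> compose V g h \<in> G"
  using subgroup.m_closed[OF sub, of g h] by (simp add: mult_eq_compose)

lemma id_in_G: "(\<lambda>x\<in>V. x) \<in> G"
  using subgroup.one_closed[OF sub] by (simp add: one_eq_id)

lemma G_inverse:
  assumes g: "g \<in> G"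
  obtains h where "h \<in> G" "\<forall>x\<in>V. h (g x) = x" "\<forall>x\<in>V. g (h x) = x"
proof -
  interpret S: group "semilinear_group R" by (rule group_semilinear_group)
  let ?h = "inv\<^bsub>semilinear_group R\<^esub> g"
  have gS: "g \<in> carrier (semilinear_group R)" using subgroup.subset[OF sub] g by blast
  have h: "?h \<in> G" using subgroup.m_inv_closed[OF sub g] .
  have "compose V ?h g = (\<lambda>x\<in>V. x)" "compose V g ?h = (\<lambda>x\<in>V. x)"
    using S.l_inv[OF gS] S.r_inv[OF gS] g h by (simp_all add: mult_eq_compose one_eq_id)
  then have "compose V ?h g x = x" "compose V g ?h x = x" if "x \<in> V" for x
    using that by simp_all
  then show thesis by (intro that[OF h] ballI) (simp_all add: compose_eq)
qed

lemma finite_G: "finite G"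
proof (rule finite_subset)
  show "G \<subseteq> V \<rightarrow>\<^sub>E V" using G_Bij by (auto simp: Bij_def PiE_def bij_betw_def)
qed (use fin in \<open>simp add: finite_PiE\<close>)

lemma aut_part_compose:
  assumes g: "g \<in> G" and h: "h \<in> G"
  shows "\<alpha> (compose V g h) = compose V (\<alpha> g) (\<alpha> h)"
proof -
  have form: "compose V g h = (\<lambda>x\<in>V. (g \<one> \<otimes> \<alpha> g (h \<one>)) \<otimes> compose V (\<alpha> g) (\<alpha> h) x)"
    using semilinear_maps_compose[OF G_form(2,1)[OF g] G_form(2,1)[OF h]]
    unfolding G_form(4)[OF g, symmetric] G_form(4)[OF h, symmetric] .
  have "g \<one> \<otimes> \<alpha> g (h \<one>) \<in> V" "g \<one> \<otimes> \<alpha> g (h \<one>) \<noteq> \<zero>"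
    using G_form[OF g] G_form[OF h] field_aut_nonzero field_aut_closed
    by (simp_all add: integral_iff)
  then show ?thesis
    unfolding form by (intro aut_part_semilinear field_aut_compose G_form(1) g h)
qed

text \<open>
  The scalars in \<open>G\<close> stand for the intersection of \<open>G\<close> with the group of multiplications, and the
  fibres for the cosets of this intersection.
\<close>

definition scalars where "scalars = {u \<in> V - {\<zero>}. (\<lambda>x\<in>V. u \<otimes> x) \<in> G}"
definition fibre where "fibre s = {g \<in> G. \<alpha> g = s}"
definition nonzero_fixed where "nonzero_fixed s = {u \<in> V - {\<zero>}. s u = u}"

lemma finite_sets [simp]: "finite scalars" "finite (fibre s)" "finite (nonzero_fixed s)"
  using fin finite_G by (auto simp: scalars_def fibre_def nonzero_fixed_def)

lemma one_in_scalars: "\<one> \<in> scalars"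
proof -
  have "(\<lambda>x\<in>V. \<one> \<otimes> x) = (\<lambda>x\<in>V. x)" by (intro restrict_ext) simp
  then show ?thesis using id_in_G by (simp add: scalars_def)
qed

text \<open>
  The quotient of two elements of \<open>G\<close> with the same automorphism part is a multiplication.
\<close>

lemma same_aut_part:
  assumes g: "g \<in> G" and h: "h \<in> G" and eq: "\<alpha> g = \<alpha> h"
  shows "h \<one> \<otimes> inv (g \<one>) \<in> scalars" "\<And>x. x \<in> V \<Longrightarrow> h x = (h \<one> \<otimes> inv (g \<one>)) \<otimes> g x"
proof -
  have u: "g \<one> \<in> Units R" using G_form[OF g] by (simp add: field_Units)
  show hx: "h x = (h \<one> \<otimes> inv (g \<one>)) \<otimes> g x" if x: "x \<in> V" for x
  proof -
    have s: "\<alpha> g x \<in> V" using G_form(1)[OF g] x by (rule field_aut_closed)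
    have "inv (g \<one>) \<otimes> g x = \<alpha> g x"
      using u s G_form(2)[OF g] unfolding G_apply[OF g x] by (simp add: m_assoc[symmetric])
    moreover have "h x = h \<one> \<otimes> \<alpha> g x" unfolding eq by (rule G_apply[OF h x])
    moreover have "(h \<one> \<otimes> inv (g \<one>)) \<otimes> g x = h \<one> \<otimes> (inv (g \<one>) \<otimes> g x)"
      using u G_form(2)[OF h] G_closed[OF g x] by (intro m_assoc) simp_all
    ultimately show ?thesis by simp
  qed
  obtain k where k: "k \<in> G" "\<forall>x\<in>V. k (g x) = x" "\<forall>x\<in>V. g (k x) = x"
    using g by (rule G_inverse)
  have "compose V h k = (\<lambda>x\<in>V. (h \<one> \<otimes> inv (g \<one>)) \<otimes> x)"
    unfolding compose_def
  proof (rule restrict_ext)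
    fix x assume x: "x \<in> V"
    show "h (k x) = (h \<one> \<otimes> inv (g \<one>)) \<otimes> x"
      using hx[OF G_closed[OF k(1) x]] k(3) x by simp
  qed
  then have "(\<lambda>x\<in>V. (h \<one> \<otimes> inv (g \<one>)) \<otimes> x) \<in> G" using compose_in_G[OF h k(1)] by simp
  moreover have "inv (g \<one>) \<noteq> \<zero>" "inv (g \<one>) \<in> V"
    using u Units_inv_Units[OF u] by (auto simp: field_Units)
  ultimately show "h \<one> \<otimes> inv (g \<one>) \<in> scalars"
    using G_form[OF h] by (simp add: scalars_def integral_iff)
qed

lemma scale_in_G:
  assumes u: "u \<in> scalars" and g: "g \<in> G"
  shows "(\<lambda>x\<in>V. u \<otimes> g x) \<in> G" "\<alpha> (\<lambda>x\<in>V. u \<otimes> g x) = \<alpha> g"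
proof -
  have uV: "u \<in> V" "u \<noteq> \<zero>" using u by (auto simp: scalars_def)
  have "compose V (\<lambda>x\<in>V. u \<otimes> x) g = (\<lambda>x\<in>V. u \<otimes> g x)"
    unfolding compose_def using G_closed[OF g] by (intro restrict_ext) simp
  then show "(\<lambda>x\<in>V. u \<otimes> g x) \<in> G" using compose_in_G[of "\<lambda>x\<in>V. u \<otimes> x" g] u g by (simp add: scalars_def)
  have "(\<lambda>x\<in>V. u \<otimes> g x) = (\<lambda>x\<in>V. (u \<otimes> g \<one>) \<otimes> \<alpha> g x)"
  proof (rule restrict_ext)
    fix x assume x: "x \<in> V"
    show "u \<otimes> g x = (u \<otimes> g \<one>) \<otimes> \<alpha> g x"
      using x uV G_form[OF g] by (subst G_apply[OF g x]) (simp add: m_assoc field_aut_closed)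
  qed
  then show "\<alpha> (\<lambda>x\<in>V. u \<otimes> g x) = \<alpha> g"
    using aut_part_semilinear[of "u \<otimes> g \<one>" "\<alpha> g"] G_form[OF g] uV by (simp add: integral_iff)
qed

lemma card_fibre:
  assumes s: "s \<in> \<alpha> ` G" shows "card (fibre s) = card scalars"
proof -
  obtain g where g: "g \<in> G" "\<alpha> g = s" using s by blast
  have g1: "g \<one> \<in> Units R" using G_form[OF g(1)] by (simp add: field_Units)
  have "bij_betw (\<lambda>h. h \<one> \<otimes> inv (g \<one>)) (fibre s) scalars"
  proof (rule bij_betw_byWitness[where f' = "\<lambda>u. \<lambda>x\<in>V. u \<otimes> g x"])
    show "(\<lambda>h. h \<one> \<otimes> inv (g \<one>)) ` fibre s \<subseteq> scalars"
      using same_aut_part(1)[OF g(1)] g(2) by (auto simp: fibre_def)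
    show "(\<lambda>u. \<lambda>x\<in>V. u \<otimes> g x) ` scalars \<subseteq> fibre s"
      using scale_in_G[OF _ g(1)] g(2) by (auto simp: fibre_def)
    show "\<forall>h\<in>fibre s. (\<lambda>x\<in>V. (h \<one> \<otimes> inv (g \<one>)) \<otimes> g x) = h"
    proof
      fix h assume h: "h \<in> fibre s"
      then have hG: "h \<in> G" "\<alpha> h = s" by (auto simp: fibre_def)
      have "(\<lambda>x\<in>V. (h \<one> \<otimes> inv (g \<one>)) \<otimes> g x) \<in> G"
        using same_aut_part(1)[OF g(1) hG(1)] g(2) hG(2) by (intro scale_in_G(1) g(1)) simp
      then show "(\<lambda>x\<in>V. (h \<one> \<otimes> inv (g \<one>)) \<otimes> g x) = h"
        using same_aut_part(2)[OF g(1) hG(1), symmetric] g(2) hG by (intro G_ext) simp_all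
    qed
    show "\<forall>u\<in>scalars. (\<lambda>x\<in>V. u \<otimes> g x) \<one> \<otimes> inv (g \<one>) = u"
      using g1 G_form(2)[OF g(1)] by (auto simp: scalars_def m_assoc)
  qed
  then show ?thesis by (rule bij_betw_same_card)
qed

end

section \<open>Counting commuting pairs\<close>

context semilinear_subgroup
begin

definition commuting where "commuting g h \<longleftrightarrow> (\<forall>x\<in>V. g (h x) = h (g x))"
definition fixed_count where "fixed_count g = card {v \<in> V - {\<zero>}. g v = v}"
text \<open>
  For commuting \<open>g\<close> and \<open>h\<close> this counts the pairs of vectors for which \<open>(v, g)\<close> and \<open>(w, h)\<close> commute
  in the semidirect product.
\<close>

definition pair_count where
  "pair_count g h = card {(v, w) \<in> V \<times> V. v \<oplus> g w = w \<oplus> h v}"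

lemma commuting_sym: "commuting g h \<longleftrightarrow> commuting h g"
  by (auto simp: commuting_def)

lemma pair_count_sym: "pair_count g h = pair_count h g"
proof -
  have "bij_betw prod.swap {(v, w) \<in> V \<times> V. v \<oplus> g w = w \<oplus> h v} {(v, w) \<in> V \<times> V. v \<oplus> h w = w \<oplus> g v}"
    by (rule bij_betw_byWitness[where f' = prod.swap]) auto
  then show ?thesis unfolding pair_count_def by (rule bij_betw_same_card)
qed

text \<open>
  If \<open>h\<close> and \<open>u * h\<close> both commute with \<open>g\<close>, then so does multiplication by \<open>u\<close>, which means that the
  automorphism part of \<open>g\<close> fixes \<open>u\<close>.
\<close>

lemma commuting_same_fibre:
  assumes g: "g \<in> G" and h: "h \<in> G" "k \<in> G" "\<alpha> h = \<alpha> k"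
    and comm: "commuting g h" "commuting g k"
  shows "k \<one> \<otimes> inv (h \<one>) \<in> scalars \<inter> nonzero_fixed (\<alpha> g)"
proof -
  let ?u = "k \<one> \<otimes> inv (h \<one>)"
  have u: "?u \<in> scalars" and kx: "\<And>x. x \<in> V \<Longrightarrow> k x = ?u \<otimes> h x"
    by (rule same_aut_part[OF h]) (rule same_aut_part(2)[OF h])
  define u where "u = ?u"
  have uV: "u \<in> V" "u \<noteq> \<zero>" using u by (auto simp: u_def scalars_def)
  interpret hs: ring_hom_cring R R "\<alpha> g" by (rule field_aut_ring_hom[OF G_form(1)[OF g]])
  define y where "y = h \<one>"
  have y: "y \<in> V" "y \<noteq> \<zero>" using G_form[OF h(1)] by (simp_all add: y_def)
  have ay: "\<alpha> g y \<in> V" using y(1) by simp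
  have gy: "g y = g \<one> \<otimes> \<alpha> g y" by (rule G_apply[OF g y(1)])
  have "g y \<noteq> \<zero>" unfolding gy
    using field_aut_nonzero[OF G_form(1)[OF g] y] G_form[OF g] ay by (simp add: integral_iff)
  have "g (k \<one>) = g (u \<otimes> y)" using kx[OF one_closed] by (simp add: u_def y_def)
  also have "\<dots> = g \<one> \<otimes> (\<alpha> g u \<otimes> \<alpha> g y)"
    using G_apply[OF g, of "u \<otimes> y"] uV(1) y(1) by simp
  also have "\<dots> = \<alpha> g u \<otimes> g y"
    unfolding gy using uV(1) ay G_form(2)[OF g] by (simp add: m_lcomm)
  finally have 1: "g (k \<one>) = \<alpha> g u \<otimes> g y" .
  have "g (k \<one>) = k (g \<one>)" using comm(2) by (simp add: commuting_def)
  also have "\<dots> = u \<otimes> h (g \<one>)" using kx[OF G_form(2)[OF g]] by (simp add: u_def)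
  also have "h (g \<one>) = g y" using comm(1) by (simp add: commuting_def y_def)
  finally have "\<alpha> g u \<otimes> g y = u \<otimes> g y" using 1 by simp
  then have "\<alpha> g u = u"
    using m_rcancel[of "g y" "\<alpha> g u" u] \<open>g y \<noteq> \<zero>\<close> G_closed[OF g y(1)] uV(1) by simp
  then show ?thesis using u uV by (simp add: nonzero_fixed_def u_def)
qed

lemma card_commuting_fibre_le:
  assumes g: "g \<in> G"
  shows "card {h \<in> fibre t. commuting g h} \<le> card (scalars \<inter> nonzero_fixed (\<alpha> g))"
proof (cases "{h \<in> fibre t. commuting g h} = {}")
  case False
  then obtain h where h: "h \<in> G" "\<alpha> h = t" "commuting g h" by (auto simp: fibre_def)
  let ?f = "\<lambda>k. k \<one> \<otimes> inv (h \<one>)"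
  have memb: "?f k \<in> scalars \<inter> nonzero_fixed (\<alpha> g)" and kx: "\<And>x. x \<in> V \<Longrightarrow> k x = ?f k \<otimes> h x"
    if "k \<in> {h \<in> fibre t. commuting g h}" for k
  proof -
    have k: "k \<in> G" "\<alpha> h = \<alpha> k" "commuting g k" using that h(2) by (auto simp: fibre_def)
    show "?f k \<in> scalars \<inter> nonzero_fixed (\<alpha> g)" by (rule commuting_same_fibre[OF g h(1) k(1,2) h(3) k(3)])
    show "k x = ?f k \<otimes> h x" if "x \<in> V" for x using h(1) k(1,2) that by (rule same_aut_part(2))
  qed
  have "inj_on ?f {h \<in> fibre t. commuting g h}"
  proof (rule inj_onI)
    fix k l assume k: "k \<in> {h \<in> fibre t. commuting g h}" and l: "l \<in> {h \<in> fibre t. commuting g h}"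
      and eq: "?f k = ?f l"
    show "k = l"
    proof (rule G_ext)
      fix x assume x: "x \<in> V"
      have "k x = ?f k \<otimes> h x" by (rule kx[OF k x])
      also have "\<dots> = ?f l \<otimes> h x" by (simp only: eq)
      also have "\<dots> = l x" by (rule kx[OF l x, symmetric])
      finally show "k x = l x" .
    qed (use k l in \<open>auto simp: fibre_def\<close>)
  qed
  then show ?thesis using memb by (intro card_inj_on_le[of ?f]) auto
next
  case True
  then show ?thesis by (simp only: card.empty)
qed

text \<open>
  A scalar fixed by the automorphism part commutes with \<open>g\<close>; hence the image of \<open>w \<mapsto> w - g w\<close> is stable
  under multiplication by the fixed field.
\<close>

lemma displacement_scale:
  assumes g: "g \<in> G" and u: "u \<in> V" "\<alpha> g u = u" and w: "w \<in> V"
  shows "u \<otimes> (w \<ominus> g w) = u \<otimes> w \<ominus> g (u \<otimes> w)"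
proof -
  interpret hs: ring_hom_cring R R "\<alpha> g" by (rule field_aut_ring_hom[OF G_form(1)[OF g]])
  have aw: "\<alpha> g w \<in> V" using w by simp
  have "g (u \<otimes> w) = g \<one> \<otimes> (u \<otimes> \<alpha> g w)" using G_apply[OF g, of "u \<otimes> w"] u w by simp
  also have "\<dots> = u \<otimes> g w"
    unfolding G_apply[OF g w] using u(1) aw G_form(2)[OF g] by (simp add: m_lcomm)
  finally show ?thesis using u(1) w G_closed[OF g w] by algebra
qed

text \<open>
  Let \<open>D\<close> be the image of the additive map \<open>w \<mapsto> w - g w\<close>, all of whose fibres have \<open>f + 1\<close> elements,
  where \<open>f\<close> is the number of nonzero fixed vectors of \<open>g\<close>. Counting the solutions of
  \<open>v - h v = w - g w\<close> amounts to counting the pairs \<open>(h, v)\<close> with \<open>v - h v\<close> in \<open>D\<close>. For \<open>v\<close> in \<open>D\<close> every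
  \<open>h\<close> may qualify, and there are at most as many \<open>h\<close> as fixed scalars. For \<open>v\<close> outside \<open>D\<close> at most one
  \<open>h\<close> qualifies: if \<open>h\<close> and \<open>u * h\<close> both do, then \<open>(u - 1) * v\<close> lies in \<open>D\<close>, and \<open>D\<close> is stable under
  division by the fixed scalar \<open>u - 1\<close>.
\<close>

lemma commuting_pairs_le:
  assumes g: "g \<in> G"
  shows "(\<Sum>h\<in>{h \<in> fibre t. commuting g h}. pair_count g h)
    \<le> card V * (card (scalars \<inter> nonzero_fixed (\<alpha> g)) + fixed_count g)"
proof -
  define c where "c = card (scalars \<inter> nonzero_fixed (\<alpha> g))"
  define H where "H = {h \<in> fibre t. commuting g h}"
  define D where "D = (\<lambda>w. w \<ominus> g w) ` V"
  define n where "n = Suc (fixed_count g)"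
  have gV: "g w \<in> V" if "w \<in> V" for w using g that by (rule G_closed)
  have HG: "h \<in> G" "commuting g h" "\<alpha> h = t" if "h \<in> H" for h using that by (auto simp: H_def fibre_def)
  have DV: "D \<subseteq> V" using gV by (auto simp: D_def)
  have finD: "finite D" "finite H" using fin by (auto simp: D_def H_def)
  have diff: "(v \<ominus> w) \<ominus> g (v \<ominus> w) = (v \<ominus> g v) \<ominus> (w \<ominus> g w)" if "v \<in> V" "w \<in> V" for v w
    using that gV[OF that(1)] gV[OF that(2)] unfolding G_minus[OF g that] by algebra
  have D_minus: "x \<ominus> y \<in> D" if xy: "x \<in> D" "y \<in> D" for x y
  proof -
    obtain v w where vw: "v \<in> V" "w \<in> V" "x = v \<ominus> g v" "y = w \<ominus> g w"
      using xy by (auto simp: D_def)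
    have "x \<ominus> y = (v \<ominus> w) \<ominus> g (v \<ominus> w)" unfolding vw(3,4) by (rule diff[OF vw(1,2), symmetric])
    then show ?thesis using vw(1,2) by (auto simp: D_def)
  qed
  have D_scale: "u \<otimes> x \<in> D" if ux: "u \<in> V" "\<alpha> g u = u" "x \<in> D" for u x
  proof -
    obtain w where w: "w \<in> V" "x = w \<ominus> g w" using ux by (auto simp: D_def)
    have "u \<otimes> x = u \<otimes> w \<ominus> g (u \<otimes> w)"
      unfolding w(2) by (rule displacement_scale[OF g ux(1,2) w(1)])
    then show ?thesis using ux(1) w(1) by (auto simp: D_def)
  qed
  have stab: "card {w \<in> V. g w = w} = n"
  proof -
    have "{w \<in> V. g w = w} = insert \<zero> {w \<in> V - {\<zero>}. g w = w}" using G_zero[OF g] by auto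
    then show ?thesis using fin by (simp add: n_def fixed_count_def)
  qed
  have fib: "card {w \<in> V. w \<ominus> g w = y} = n" if y: "y \<in> D" for y
  proof -
    obtain v where v: "v \<in> V" "y = v \<ominus> g v" using y by (auto simp: D_def)
    have "bij_betw (\<lambda>w. w \<ominus> v) {w \<in> V. w \<ominus> g w = y} {w \<in> V. g w = w}"
    proof (rule bij_betw_byWitness[where f' = "\<lambda>w. w \<oplus> v"])
      show "(\<lambda>w. w \<ominus> v) ` {w \<in> V. w \<ominus> g w = y} \<subseteq> {w \<in> V. g w = w}"
      proof clarify
        fix w assume w: "w \<in> V" "y = w \<ominus> g w"
        have "(w \<ominus> v) \<ominus> g (w \<ominus> v) = \<zero>" using diff[OF w(1) v(1)] w v gV by simp
        then show "w \<ominus> v \<in> V \<and> g (w \<ominus> v) = w \<ominus> v" using w(1) v(1) gV[of "w \<ominus> v"] by simp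
      qed
      show "(\<lambda>w. w \<oplus> v) ` {w \<in> V. g w = w} \<subseteq> {w \<in> V. w \<ominus> g w = y}"
      proof clarify
        fix w assume w: "w \<in> V" "g w = w"
        have "(w \<oplus> v) \<ominus> g (w \<oplus> v) = v \<ominus> g v"
          using w v(1) gV[OF v(1)] unfolding G_add[OF g w(1) v(1)] w(2) by algebra
        then show "w \<oplus> v \<in> V \<and> (w \<oplus> v) \<ominus> g (w \<oplus> v) = y" using w(1) v by simp
      qed
      show "\<forall>w\<in>{w \<in> V. w \<ominus> g w = y}. (w \<ominus> v) \<oplus> v = w" using v(1) by (simp, algebra)
      show "\<forall>w\<in>{w \<in> V. g w = w}. (w \<oplus> v) \<ominus> v = w" using v(1) by (simp, algebra)
    qed
    then show ?thesis using stab by (simp add: bij_betw_same_card)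
  qed
  have cardV: "card V = n * card D"
  proof -
    have "card V = (\<Sum>y\<in>D. card {w \<in> V. w \<ominus> g w = y})"
      using sum.image_gen[OF fin, of "\<lambda>_. 1::nat" "\<lambda>w. w \<ominus> g w"] by (simp add: D_def)
    then show ?thesis using fib by simp
  qed
  have pc: "pair_count g h = n * card {v \<in> V. v \<ominus> h v \<in> D}" if h: "h \<in> H" for h
  proof -
    have hV: "h v \<in> V" if "v \<in> V" for v using HG(1)[OF h] that by (rule G_closed)
    have "{(v, w) \<in> V \<times> V. v \<oplus> g w = w \<oplus> h v}
        = (SIGMA v:{v \<in> V. v \<ominus> h v \<in> D}. {w \<in> V. w \<ominus> g w = v \<ominus> h v})"
    proof -
      have eqv: "v \<oplus> g w = w \<oplus> h v \<longleftrightarrow> w \<ominus> g w = v \<ominus> h v" if vw: "v \<in> V" "w \<in> V" for v w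
      proof -
        have c: "g w \<in> V" "h v \<in> V" using gV hV vw by simp_all
        have "w \<ominus> g w = v \<ominus> h v" if "v \<oplus> g w = w \<oplus> h v"
        proof -
          have "w \<ominus> g w = (w \<oplus> h v) \<ominus> g w \<ominus> h v" using vw c by algebra
          also have "\<dots> = (v \<oplus> g w) \<ominus> g w \<ominus> h v" by (simp add: that)
          also have "\<dots> = v \<ominus> h v" using vw c by algebra
          finally show ?thesis .
        qed
        moreover have "v \<oplus> g w = w \<oplus> h v" if "w \<ominus> g w = v \<ominus> h v"
        proof -
          have "v \<oplus> g w = (v \<ominus> h v) \<oplus> h v \<oplus> g w" using vw c by algebra
          also have "\<dots> = (w \<ominus> g w) \<oplus> h v \<oplus> g w" by (simp add: that)
          also have "\<dots> = w \<oplus> h v" using vw c by algebra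
          finally show ?thesis .
        qed
        ultimately show ?thesis by blast
      qed
      have memD: "w \<ominus> g w \<in> D" if "w \<in> V" for w using that by (auto simp: D_def)
      show ?thesis by (auto simp: eqv) (metis memD)
    qed
    then have "pair_count g h = (\<Sum>v\<in>{v \<in> V. v \<ominus> h v \<in> D}. card {w \<in> V. w \<ominus> g w = v \<ominus> h v})"
      unfolding pair_count_def using fin by (simp add: card_SigmaI)
    also have "\<dots> = (\<Sum>v\<in>{v \<in> V. v \<ominus> h v \<in> D}. n)" by (intro sum.cong) (auto simp: fib)
    finally show ?thesis by simp
  qed
  have one: "card {h \<in> H. v \<ominus> h v \<in> D} \<le> 1" if v: "v \<in> V" "v \<notin> D" for v
  proof -
    have "h = k" if hk: "h \<in> H" "k \<in> H" "v \<ominus> h v \<in> D" "v \<ominus> k v \<in> D" for h k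
    proof (rule ccontr)
      assume neq: "h \<noteq> k"
      have kV: "k v \<in> V" "h v \<in> V" using HG(1) hk v(1) by (auto intro: G_closed)
      have eq: "\<alpha> h = \<alpha> k" using HG(3) hk by simp
      obtain u where u: "u \<in> scalars \<inter> nonzero_fixed (\<alpha> g)" and kx: "\<And>x. x \<in> V \<Longrightarrow> k x = u \<otimes> h x"
        using commuting_same_fibre[OF g HG(1)[OF hk(1)] HG(1)[OF hk(2)] eq HG(2)[OF hk(1)] HG(2)[OF hk(2)]]
          same_aut_part(2)[OF HG(1)[OF hk(1)] HG(1)[OF hk(2)] eq] by blast
      have uV: "u \<in> V" "\<alpha> g u = u" using u by (auto simp: nonzero_fixed_def)
      interpret hs: ring_hom_cring R R "\<alpha> g" by (rule field_aut_ring_hom[OF G_form(1)[OF g]])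
      have u1: "u \<noteq> \<one>"
      proof
        assume "u = \<one>"
        then have "h = k" using HG(1) hk kx G_closed[OF HG(1)[OF hk(1)]] by (intro G_ext) simp_all
        then show False using neq by simp
      qed
      have nz: "u \<ominus> \<one> \<noteq> \<zero>" using u1 uV by simp
      \<comment> \<open>The automorphism part fixes \<open>u - 1\<close>, hence also its inverse \<open>b\<close>, which therefore preserves \<open>D\<close>.\<close>
      define b where "b = inv (u \<ominus> \<one>)"
      have un: "u \<ominus> \<one> \<in> Units R" using nz uV by (simp add: field_Units)
      have bV: "b \<in> V" and b1: "b \<otimes> (u \<ominus> \<one>) = \<one>" using un by (simp_all add: b_def)
      have "\<alpha> g (u \<ominus> \<one>) = u \<ominus> \<one>" using uV by (simp add: a_minus_def)
      then have "\<alpha> g b \<otimes> (u \<ominus> \<one>) = \<one>"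
        using b1 bV uV hs.hom_mult[of b "u \<ominus> \<one>"] by simp
      then have bfix: "\<alpha> g b = b"
        using b1 bV uV nz m_rcancel[of "u \<ominus> \<one>" "\<alpha> g b" b] by simp
      have "(u \<ominus> \<one>) \<otimes> v = u \<otimes> v \<ominus> v" using uV v(1) by algebra
      also have "\<dots> = u \<otimes> (v \<ominus> h v) \<ominus> (v \<ominus> k v)"
        using uV(1) v(1) kV(2) unfolding kx[OF v(1)] by algebra
      finally have "(u \<ominus> \<one>) \<otimes> v \<in> D" using D_minus D_scale[OF uV hk(3)] hk(4) by simp
      then have "b \<otimes> ((u \<ominus> \<one>) \<otimes> v) \<in> D" by (rule D_scale[OF bV bfix])
      moreover have "b \<otimes> ((u \<ominus> \<one>) \<otimes> v) = v"
        using bV b1 uV v(1) by (simp add: m_assoc[symmetric])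
      ultimately show False using v(2) by simp
    qed
    then show ?thesis using finD by (auto simp: card_le_Suc0_iff_eq)
  qed
  have many: "card {h \<in> H. v \<ominus> h v \<in> D} \<le> c" for v
  proof -
    have "card {h \<in> H. v \<ominus> h v \<in> D} \<le> card H" using finD by (intro card_mono) auto
    then show ?thesis using card_commuting_fibre_le[OF g, of t] by (simp add: H_def c_def)
  qed
  have "(\<Sum>h\<in>H. pair_count g h) = n * (\<Sum>h\<in>H. card {v \<in> V. v \<ominus> h v \<in> D})"
    by (simp add: pc sum_distrib_left)
  also have "(\<Sum>h\<in>H. card {v \<in> V. v \<ominus> h v \<in> D}) = (\<Sum>v\<in>V. card {h \<in> H. v \<ominus> h v \<in> D})"
    using sum.swap[of "\<lambda>h v. if v \<ominus> h v \<in> D then 1 else 0::nat" V H] fin finD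
    by (simp add: sum.If_cases Int_def Collect_conj_eq[symmetric])
  also have "\<dots> = (\<Sum>v\<in>D. card {h \<in> H. v \<ominus> h v \<in> D}) + (\<Sum>v\<in>V - D. card {h \<in> H. v \<ominus> h v \<in> D})"
    using DV fin by (simp add: sum.subset_diff add.commute)
  also have "\<dots> \<le> card D * c + card (V - D) * 1"
  proof (rule add_mono)
    show "(\<Sum>v\<in>D. card {h \<in> H. v \<ominus> h v \<in> D}) \<le> card D * c"
      using sum_bounded_above[of D "\<lambda>v. card {h \<in> H. v \<ominus> h v \<in> D}" c] many by simp
    show "(\<Sum>v\<in>V - D. card {h \<in> H. v \<ominus> h v \<in> D}) \<le> card (V - D) * 1"
      using sum_bounded_above[of "V - D" "\<lambda>v. card {h \<in> H. v \<ominus> h v \<in> D}" 1] one by simp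
  qed
  finally have "(\<Sum>h\<in>H. pair_count g h) \<le> n * (card D * c + card (V - D))" by simp
  also have "\<dots> = card V * (c + fixed_count g)"
  proof -
    have "card (V - D) = card V - card D" using DV finD by (simp add: card_Diff_subset)
    also have "\<dots> = fixed_count g * card D" by (simp add: cardV n_def)
    finally show ?thesis by (simp add: cardV algebra_simps)
  qed
  finally show ?thesis by (simp add: H_def c_def)
qed

text \<open>
  The quotient of two nonzero fixed vectors of \<open>g\<close> is fixed by the automorphism part.
\<close>

lemma fixed_count_le_nonzero_fixed:
  assumes g: "g \<in> G" shows "fixed_count g \<le> card (nonzero_fixed (\<alpha> g))"
proof (cases "{v \<in> V - {\<zero>}. g v = v} = {}")
  case True
  then show ?thesis unfolding fixed_count_def by (simp only: card.empty)
next
  case False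
  then obtain v where v: "v \<in> V" "v \<noteq> \<zero>" "g v = v" by blast
  then have vu: "v \<in> Units R" by (simp add: field_Units)
  interpret hs: ring_hom_cring R R "\<alpha> g" by (rule field_aut_ring_hom[OF G_form(1)[OF g]])
  have "w \<otimes> inv v \<in> nonzero_fixed (\<alpha> g)" if w: "w \<in> V" "w \<noteq> \<zero>" "g w = w" for w
  proof -
    define u where "u = w \<otimes> inv v"
    have uV: "u \<in> V" and wu: "w = u \<otimes> v" using w(1) v(1) vu by (simp_all add: u_def m_assoc)
    have av: "\<alpha> g v \<in> V" "\<alpha> g u \<in> V" using v(1) uV by simp_all
    have "u \<otimes> v = g \<one> \<otimes> (\<alpha> g u \<otimes> \<alpha> g v)"
      using G_apply[OF g w(1)] w(3) uV v(1) by (simp add: wu)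
    also have "\<dots> = \<alpha> g u \<otimes> g v"
      unfolding G_apply[OF g v(1)] using av G_form(2)[OF g] by (simp add: m_lcomm)
    finally have "\<alpha> g u \<otimes> v = u \<otimes> v" using v(3) by simp
    then have "\<alpha> g u = u" using m_rcancel[of v "\<alpha> g u" u] v av uV by simp
    moreover have "u \<noteq> \<zero>" using w(2) wu v(1) by auto
    ultimately show ?thesis using uV by (simp add: nonzero_fixed_def u_def)
  qed
  moreover have "inj_on (\<lambda>w. w \<otimes> inv v) {v \<in> V - {\<zero>}. g v = v}"
  proof (rule inj_onI)
    fix x y assume xy: "x \<in> {v \<in> V - {\<zero>}. g v = v}" "y \<in> {v \<in> V - {\<zero>}. g v = v}"
      "x \<otimes> inv v = y \<otimes> inv v"
    then have "(x \<otimes> inv v) \<otimes> v = (y \<otimes> inv v) \<otimes> v" by simp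
    then show "x = y" using xy(1,2) v(1) vu by (simp add: m_assoc)
  qed
  ultimately show ?thesis
    unfolding fixed_count_def by (intro card_inj_on_le[of "\<lambda>w. w \<otimes> inv v"]) auto
qed

text \<open>
  A nonzero vector is fixed by at most one map with the given automorphism part.
\<close>

lemma sum_fixed_count_fibre_le:
  "(\<Sum>g\<in>fibre s. fixed_count g) \<le> card V - 1"
proof -
  let ?V = "V - {\<zero>}"
  have one: "card {g \<in> fibre s. g v = v} \<le> 1" if v: "v \<in> ?V" for v
  proof -
    have "g = h" if gh: "g \<in> fibre s" "h \<in> fibre s" "g v = v" "h v = v" for g h
    proof -
      have G: "g \<in> G" "h \<in> G" and a: "\<alpha> g = s" "\<alpha> h = s" using gh by (auto simp: fibre_def)
      have vV: "v \<in> V" "v \<noteq> \<zero>" using v by auto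
      have sa: "s \<in> field_auts R" using G_form(1)[OF G(1)] a by simp
      have sv: "s v \<in> V" "s v \<noteq> \<zero>"
        using field_aut_closed[OF sa vV(1)] field_aut_nonzero[OF sa vV] by simp_all
      have "g \<one> \<otimes> s v = h \<one> \<otimes> s v"
        using G_apply[OF G(1) vV(1)] G_apply[OF G(2) vV(1)] gh a by simp
      then have one: "g \<one> = h \<one>"
        using m_rcancel[of "s v" "g \<one>" "h \<one>"] sv G_form(2)[OF G(1)] G_form(2)[OF G(2)] by simp
      show "g = h"
      proof (rule G_ext[OF G])
        fix x assume x: "x \<in> V"
        show "g x = h x"
          unfolding G_apply[OF G(1) x] G_apply[OF G(2) x] one a ..
      qed
    qed
    then show ?thesis by (auto simp: card_le_Suc0_iff_eq)
  qed
  have "(\<Sum>g\<in>fibre s. fixed_count g) = (\<Sum>v\<in>?V. card {g \<in> fibre s. g v = v})"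
    using sum.swap_restrict[of "fibre s" ?V "\<lambda>_ _. 1::nat" "\<lambda>g v. g v = v"] fin
    by (simp add: fixed_count_def)
  also have "\<dots> \<le> card ?V"
    using sum_bounded_above[of ?V "\<lambda>v. card {g \<in> fibre s. g v = v}" 1] one by simp
  also have "\<dots> = card V - 1" using fin by simp
  finally show ?thesis .
qed

abbreviation aut_parts where "aut_parts \<equiv> \<alpha> ` G"
abbreviation ident where "ident \<equiv> (\<lambda>x\<in>V. x)"

lemma sum_fibres: "sum f G = (\<Sum>s\<in>aut_parts. sum f (fibre s))" for f :: "('a \<Rightarrow> 'a) \<Rightarrow> nat"
  using sum.image_gen[OF finite_G, of f \<alpha>] by (simp add: fibre_def)

lemma card_G: "card G = card aut_parts * card scalars"
  using sum_fibres[of "\<lambda>_. 1"] card_fibre by simp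

lemma ident_in_A: "ident \<in> aut_parts"
proof -
  have "(\<lambda>x\<in>V. \<one> \<otimes> ident x) = ident" by (intro restrict_ext) simp
  then have "\<alpha> ident = ident"
    using aut_part_semilinear[OF one_closed one_not_zero field_aut_id] by simp
  then show ?thesis by (intro image_eqI[OF _ id_in_G]) (rule sym)
qed

definition fibre_pairs where
  "fibre_pairs s t = (\<Sum>g\<in>fibre s. \<Sum>h\<in>{h \<in> fibre t. commuting g h}. pair_count g h)"

lemma fibre_pairs_sym: "fibre_pairs s t = fibre_pairs t s"
proof -
  have "fibre_pairs s t = (\<Sum>h\<in>fibre t. \<Sum>g\<in>{g \<in> fibre s. commuting g h}. pair_count g h)"
    unfolding fibre_pairs_def by (rule sum.swap_restrict) simp_all
  also have "\<dots> = fibre_pairs t s"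
    unfolding fibre_pairs_def
    by (intro sum.cong refl pair_count_sym Collect_cong conj_cong commuting_sym)
  finally show ?thesis .
qed

text \<open>
  The bound of \<open>commuting_pairs_le\<close>, summed over the fibre of \<open>s\<close> and divided by \<open>q\<close>.
\<close>

definition weight where
  "weight s = card scalars * card (scalars \<inter> nonzero_fixed s) + (\<Sum>g\<in>fibre s. fixed_count g)"

lemma fibre_pairs_le:
  assumes "s \<in> aut_parts" shows "fibre_pairs s t \<le> card V * weight s"
proof -
  have "fibre_pairs s t \<le> (\<Sum>g\<in>fibre s. card V * (card (scalars \<inter> nonzero_fixed s) + fixed_count g))"
    unfolding fibre_pairs_def
  proof (rule sum_mono)
    fix g assume "g \<in> fibre s"
    then have "g \<in> G" "\<alpha> g = s" by (auto simp: fibre_def)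
    then show "(\<Sum>h\<in>{h \<in> fibre t. commuting g h}. pair_count g h)
        \<le> card V * (card (scalars \<inter> nonzero_fixed s) + fixed_count g)"
      using commuting_pairs_le[of g t] by simp
  qed
  also have "\<dots> = card V * weight s"
    by (simp add: weight_def sum.distrib card_fibre[OF assms] flip: sum_distrib_left)
  finally show ?thesis .
qed

lemma weight_le:
  assumes "s \<in> aut_parts"
  shows "weight s \<le> card scalars * min (card scalars) (card (nonzero_fixed s)) + min (card scalars * card (nonzero_fixed s)) (card V - 1)"
proof -
  have "(\<Sum>g\<in>fibre s. fixed_count g) \<le> (\<Sum>g\<in>fibre s. card (nonzero_fixed s))"
    using fixed_count_le_nonzero_fixed by (intro sum_mono) (auto simp: fibre_def)
  then have "(\<Sum>g\<in>fibre s. fixed_count g) \<le> card scalars * card (nonzero_fixed s)"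
    by (simp add: card_fibre[OF assms])
  moreover have "card (scalars \<inter> nonzero_fixed s) \<le> min (card scalars) (card (nonzero_fixed s))"
    by (simp add: card_mono)
  ultimately show ?thesis
    unfolding weight_def using sum_fixed_count_fibre_le[of s] by (intro add_mono mult_le_mono2) simp_all
qed

lemma weight_ident_le: "weight ident \<le> card scalars ^ 2 + (card V - 1)"
proof -
  have "card (scalars \<inter> nonzero_fixed ident) \<le> card scalars" by (simp add: card_mono)
  then show ?thesis
    unfolding weight_def power2_eq_square
    using sum_fixed_count_fibre_le[of ident] by (intro add_mono mult_le_mono2)
qed

definition total_pairs where
  "total_pairs = (\<Sum>g\<in>G. \<Sum>h\<in>{h \<in> G. commuting g h}. pair_count g h)"

lemma total_pairs_eq: "total_pairs = (\<Sum>s\<in>aut_parts. \<Sum>t\<in>aut_parts. fibre_pairs s t)"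
proof -
  have "(\<Sum>h\<in>{h \<in> G. commuting g h}. pair_count g h)
      = (\<Sum>t\<in>aut_parts. \<Sum>h\<in>{h \<in> fibre t. commuting g h}. pair_count g h)" for g
    using sum_fibres[of "\<lambda>h. if commuting g h then pair_count g h else 0"] finite_G
    by (simp add: sum.inter_filter)
  then have "total_pairs = (\<Sum>s\<in>aut_parts. \<Sum>g\<in>fibre s. \<Sum>t\<in>aut_parts. \<Sum>h\<in>{h \<in> fibre t. commuting g h}. pair_count g h)"
    by (simp add: total_pairs_def sum_fibres)
  also have "\<dots> = (\<Sum>s\<in>aut_parts. \<Sum>t\<in>aut_parts. fibre_pairs s t)"
    unfolding fibre_pairs_def by (intro sum.cong refl sum.swap)
  finally show ?thesis .
qed

text \<open>
  A pair of automorphism parts is charged to its first component, or to its second one if the first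
  is the identity. So every nontrivial automorphism is charged once for each second component and once
  more for the identity as first component.
\<close>

lemma total_pairs_le:
  "total_pairs \<le> card V * (card scalars ^ 2 + (card V - 1) + (card aut_parts + 1) *
     (\<Sum>s\<in>aut_parts - {ident}. card scalars * min (card scalars) (card (nonzero_fixed s)) + min (card scalars * card (nonzero_fixed s)) (card V - 1)))"
proof -
  let ?w = "\<lambda>s. card scalars * min (card scalars) (card (nonzero_fixed s)) + min (card scalars * card (nonzero_fixed s)) (card V - 1)"
  let ?q = "card V"
  have finA: "finite aut_parts" using finite_G by simp
  have split: "sum f aut_parts = f ident + sum f (aut_parts - {ident})" for f :: "('a \<Rightarrow> 'a) \<Rightarrow> nat"
    using finA ident_in_A by (rule sum.remove)
  have le: "fibre_pairs s t \<le> ?q * ?w s" if "s \<in> aut_parts" for s t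
    using fibre_pairs_le[OF that] weight_le[OF that] by (meson le_trans mult_le_mono2)
  have 1: "fibre_pairs ident ident \<le> ?q * (card scalars ^ 2 + (?q - 1))"
    using fibre_pairs_le[OF ident_in_A] weight_ident_le by (meson le_trans mult_le_mono2)
  have 2: "(\<Sum>t\<in>aut_parts - {ident}. fibre_pairs ident t) \<le> (\<Sum>t\<in>aut_parts - {ident}. ?q * ?w t)"
    using le by (intro sum_mono) (auto simp: fibre_pairs_sym[of ident])
  have "(\<Sum>t\<in>aut_parts. fibre_pairs s t) \<le> card aut_parts * (?q * ?w s)" if "s \<in> aut_parts" for s
    using sum_bounded_above[of aut_parts "fibre_pairs s" "?q * ?w s"] le[OF that] by simp
  then have 3: "(\<Sum>s\<in>aut_parts - {ident}. \<Sum>t\<in>aut_parts. fibre_pairs s t) \<le> (\<Sum>s\<in>aut_parts - {ident}. card aut_parts * (?q * ?w s))"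
    by (intro sum_mono) auto
  have "total_pairs = fibre_pairs ident ident + (\<Sum>t\<in>aut_parts - {ident}. fibre_pairs ident t)
      + (\<Sum>s\<in>aut_parts - {ident}. \<Sum>t\<in>aut_parts. fibre_pairs s t)"
    unfolding total_pairs_eq split[of "\<lambda>s. \<Sum>t\<in>aut_parts. fibre_pairs s t"]
    by (simp only: split[of "fibre_pairs ident"])
  also have "\<dots> \<le> ?q * (card scalars ^ 2 + (?q - 1)) + (\<Sum>t\<in>aut_parts - {ident}. ?q * ?w t)
      + (\<Sum>s\<in>aut_parts - {ident}. card aut_parts * (?q * ?w s))"
    using 1 2 3 by linarith
  also have "\<dots> = ?q * (card scalars ^ 2 + (?q - 1) + (card aut_parts + 1) * (\<Sum>s\<in>aut_parts - {ident}. ?w s))"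
    unfolding sum_distrib_left[symmetric] by (simp only: distrib_left distrib_right mult.left_commute mult_1)
  finally show ?thesis .
qed

end

section \<open>The numerical inequality\<close>

text \<open>
  An upper bound for the number of pairs of a nontrivial element of a cyclic group of order \<open>d\<close> of
  automorphisms of a field with \<open>r ^ d\<close> elements and a nonzero element that it fixes.
\<close>

definition fixed_point_weight :: "nat \<Rightarrow> nat \<Rightarrow> nat" where
  "fixed_point_weight r d = (\<Sum>i\<in>{1..<d}. r ^ min i (d - i) - 1)"

text \<open>
  Apart from the two outermost terms, raising \<open>d\<close> by two raises every exponent by one.
\<close>

lemma fixed_point_weight_Suc_Suc:
  assumes "r \<ge> 1" "d \<ge> 1"
  shows "fixed_point_weight r (d + 2) = r * fixed_point_weight r d + (d + 1) * (r - 1)"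
proof -
  let ?f = "\<lambda>i. r ^ min i (d + 2 - i) - 1"
  have step: "?f (Suc j) = r * (r ^ min j (d - j) - 1) + (r - 1)" if "j \<in> {1..<d}" for j
  proof -
    have "min (Suc j) (d + 2 - Suc j) = Suc (min j (d - j))" using that by auto
    moreover obtain z where "r ^ min j (d - j) = Suc z"
      using assms(1) by (metis One_nat_def Suc_le_D one_le_power)
    ultimately show ?thesis using assms(1) by simp
  qed
  have "{1..<d + 2} = insert 1 (insert (d + 1) (Suc ` {1..<d}))"
    using assms(2) by (auto simp: image_Suc_atLeastLessThan)
  then have "fixed_point_weight r (d + 2) = ?f 1 + ?f (d + 1) + (\<Sum>i\<in>Suc ` {1..<d}. ?f i)"
    using assms(2) by (simp add: fixed_point_weight_def image_Suc_atLeastLessThan)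
  also have "(\<Sum>i\<in>Suc ` {1..<d}. ?f i) = (\<Sum>j\<in>{1..<d}. r * (r ^ min j (d - j) - 1) + (r - 1))"
    by (subst sum.reindex) (use step in \<open>auto intro!: sum.cong\<close>)
  also have "\<dots> = r * fixed_point_weight r d + (d - 1) * (r - 1)"
    by (simp add: sum.distrib sum_distrib_left fixed_point_weight_def)
  finally have "fixed_point_weight r (d + 2)
      = (r - 1) + (r - 1) + (r * fixed_point_weight r d + (d - 1) * (r - 1))"
    using assms(2) by (simp add: min_def)
  moreover have "d + 1 = (d - 1) + 2" using assms(2) by simp
  ultimately show ?thesis by (simp only: add_mult_distrib)
qed

lemma fixed_point_weight_small:
  "fixed_point_weight r 1 = 0" "fixed_point_weight r 2 = r - 1"
  "fixed_point_weight r 3 = 2 * (r - 1)" "fixed_point_weight r 4 = 2 * (r - 1) + (r ^ 2 - 1)"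
  by (simp_all add: fixed_point_weight_def numeral_eq_Suc atLeastLessThanSuc)

text \<open>
  The recursion lowers \<open>d\<close> by two down to 3 or 4. For \<open>r = 2\<close> the bound fails at \<open>d = 4\<close>, so there the
  induction for even \<open>d\<close> starts at 6.
\<close>

lemma fixed_point_weight_le:
  assumes "r \<ge> 2" "d \<ge> 3" "\<not> (r = 2 \<and> d = 4)"
  shows "4 * fixed_point_weight r d \<le> r ^ d"
  using assms(2,3)
proof (induction d rule: less_induct)
  case (less d)
  consider "d = 3" | "d = 4" | "r = 2 \<and> d = 6" | "d \<ge> 5" "\<not> (r = 2 \<and> d = 6)"
    using less.prems by linarith
  then show ?case
  proof cases
    case 1
    have "8 * (r - 1) \<le> r ^ 3"
    proof (cases "r = 2")
      case False
      then have "3 * 3 * r \<le> r * r * r" using assms(1) by (intro mult_mono) auto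
      then show ?thesis unfolding power3_eq_cube by linarith
    qed auto
    then show ?thesis using 1 by (simp add: fixed_point_weight_small)
  next
    case 2
    then have r: "r \<ge> 3" using assms(1) less.prems by auto
    have "3 * 3 * r^2 \<le> r * r * r^2" "3 * r \<le> r * r" using r by (intro mult_mono; simp)+
    then have "9 * r^2 \<le> r^4" "3 * r \<le> r^2" by (simp_all add: power_numeral_reduce)
    then show ?thesis using 2 by (simp add: fixed_point_weight_small)
  next
    case 3
    then show ?thesis
      using fixed_point_weight_Suc_Suc[of r 4] by (simp add: fixed_point_weight_small)
  next
    case 4
    define e where "e = d - 2"
    have e: "e \<ge> 3" "d = e + 2" using 4 by (simp_all add: e_def)
    have IH: "4 * fixed_point_weight r e \<le> r ^ e"
      using 4 e by (intro less.IH) auto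
    have "4 * (e' + 1) \<le> (2::nat) ^ (e' + 1)" if "e' \<ge> 3" for e'
      using that by (induction e' rule: nat_induct_at_least) auto
    then have "4 * (e + 1) \<le> (2::nat) ^ (e + 1)" using e(1) .
    also have "\<dots> \<le> r ^ (e + 1)" using assms(1) by (intro power_mono) auto
    finally have "4 * (e + 1) * (r - 1) \<le> r ^ (e + 1) * (r - 1)" by simp
    moreover have "r * (4 * fixed_point_weight r e) \<le> r * r ^ e" using IH by (rule mult_le_mono2)
    moreover have "r ^ (e + 1) * (r - 1) + r * r ^ e = r ^ d"
      using assms(1) e(2) by (cases r) auto
    moreover have "4 * fixed_point_weight r d
        = r * (4 * fixed_point_weight r e) + 4 * (e + 1) * (r - 1)"
      using fixed_point_weight_Suc_Suc[of r e] assms(1) e by (simp add: algebra_simps)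
    ultimately show ?thesis by linarith
  qed
qed

lemma atLeastLessThan_two_four: "{Suc 0..<2} = {1::nat}" "{Suc 0..<4} = {1, 2, 3::nat}"
  by auto

lemma nat_between_1_15:
  "\<lbrakk>1 \<le> m; m \<le> 15\<rbrakk> \<Longrightarrow> m \<in> {1,2,3,4,5,6,7,8,9,10,11,12,13,14,15::nat}"
proof -
  assume "1 \<le> m" "m \<le> 15"
  then have "m \<in> {..15}" "m \<noteq> 0" by simp_all
  then show ?thesis by (auto simp: atMost_nat_numeral)
qed

text \<open>
  Dropping the minima leaves the sufficient condition \<open>2 * (d + 1) * T \<le> (d - 1) * q\<close>, where \<open>T\<close> is the
  weight above. It holds except for \<open>(r, d)\<close> among \<open>(2, 2)\<close>, \<open>(3, 2)\<close>, \<open>(4, 2)\<close> and \<open>(2, 4)\<close>. In the last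
  three cases \<open>q\<close> is 9 or 16, and the inequality with its minima gives the claim for each value
  of \<open>m\<close>.
\<close>

lemma class_number_arithmetic:
  fixes k m q r d :: nat
  defines "y \<equiv> \<lambda>i. r ^ min i (d - i) - 1"
  assumes k: "k * d * m \<le> m ^ 2 + (q - 1)
      + (d + 1) * (\<Sum>i\<in>{1..<d}. m * min m (y i) + min (m * y i) (q - 1))"
    and "q = r ^ d" "r \<ge> 2" "d \<ge> 1" "1 \<le> m" "m \<le> q - 1" "\<not> (r = 2 \<and> d = 2)"
  shows "k \<le> q"
proof -
  \<comment> \<open>Equivalent to \<open>(m - 1) * (q - 1 - m) \<ge> 0\<close>.\<close>
  have mq: "m ^ 2 + (q - 1) \<le> m * q"
  proof -
    obtain u where u: "q - 1 = m + u" using assms(7) by (metis le_iff_add)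
    then have "q = Suc (m + u)" using assms(6,7) by simp
    then show ?thesis using assms(6) by (cases m) (auto simp: power2_eq_square algebra_simps)
  qed
  show ?thesis
  proof (cases "2 * (d + 1) * fixed_point_weight r d \<le> (d - 1) * q")
    case True
    have "(\<Sum>i\<in>{1..<d}. m * min m (y i) + min (m * y i) (q - 1)) \<le> (\<Sum>i\<in>{1..<d}. 2 * m * y i)"
      by (intro sum_mono) (simp add: add_mono mult_2 distrib_right)
    also have "\<dots> = 2 * m * fixed_point_weight r d"
      by (simp add: fixed_point_weight_def y_def sum_distrib_left)
    finally have "(d + 1) * (\<Sum>i\<in>{1..<d}. m * min m (y i) + min (m * y i) (q - 1))
        \<le> (d + 1) * (2 * m * fixed_point_weight r d)"
      by (rule mult_le_mono2)
    also have "\<dots> = m * (2 * (d + 1) * fixed_point_weight r d)" by (simp add: algebra_simps)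
    also have "\<dots> \<le> m * ((d - 1) * q)" using True by (rule mult_le_mono2)
    finally have "k * d * m \<le> m * q + m * ((d - 1) * q)" using k mq by linarith
    also have "\<dots> = q * d * m" using assms(5) by (cases d) (auto simp: algebra_simps)
    finally show ?thesis using assms(5,6) by simp
  next
    case False
    have "d \<noteq> 1" using False fixed_point_weight_small(1)[of r] by auto
    moreover have "(r = 2 \<and> d = 4)" if "d \<ge> 3"
    proof (rule ccontr)
      assume "\<not> ?thesis"
      then have "4 * fixed_point_weight r d \<le> q"
        using fixed_point_weight_le that assms by simp
      then have "(d - 1) * (4 * fixed_point_weight r d) \<le> (d - 1) * q" by (rule mult_le_mono2)
      moreover have "2 * (d + 1) \<le> 4 * (d - 1)" using that by simp
      then have "2 * (d + 1) * fixed_point_weight r d \<le> 4 * (d - 1) * fixed_point_weight r d"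
        by (rule mult_le_mono1)
      ultimately show False using False by (simp add: algebra_simps)
    qed
    moreover have "r < 5" if "d = 2"
    proof (rule ccontr)
      assume "\<not> r < 5"
      then consider "r = 5" | "r \<ge> 6" by linarith
      then have "6 * (r - 1) \<le> r * r"
      proof cases
        case 2
        then have "6 * r \<le> r * r" by simp
        then show ?thesis by linarith
      qed simp
      then show False
        using False that assms(3) by (simp add: fixed_point_weight_small power2_eq_square)
    qed
    ultimately consider "r = 2" "d = 4" | "r = 3" "d = 2" | "r = 4" "d = 2"
      using assms(4,5,8) by linarith
    then show ?thesis
    proof cases
      case 1
      then have "k * 4 * m \<le> m ^ 2 + 15 + 5 * (2 * (m + min m 15) + (m * min m 3 + min (m * 3) 15))"
        using k assms(3,6) by (simp add: y_def atLeastLessThan_two_four)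
      moreover have "m \<in> {1,2,3,4,5,6,7,8,9,10,11,12,13,14,15}"
        using 1 assms(3,6,7) by (intro nat_between_1_15) simp_all
      ultimately have "k \<le> 16" by (elim insertE emptyE) simp_all
      then show ?thesis using 1 assms(3) by simp
    next
      case 2
      then have "k * 2 * m \<le> m ^ 2 + 8 + 3 * (m * min m 2 + min (m * 2) 8)"
        using k assms(3) by (simp add: y_def atLeastLessThan_two_four)
      moreover have "m \<in> {1,2,3,4,5,6,7,8}"
        using 2 assms(3,6,7) by auto
      ultimately have "k \<le> 9" by (elim insertE emptyE) simp_all
      then show ?thesis using 2 assms(3) by simp
    next
      case 3
      then have "k * 2 * m \<le> m ^ 2 + 15 + 3 * (m * min m 3 + min (m * 3) 15)"
        using k assms(3) by (simp add: y_def atLeastLessThan_two_four)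
      moreover have "m \<in> {1,2,3,4,5,6,7,8,9,10,11,12,13,14,15}"
        using 3 assms(3,6,7) by (intro nat_between_1_15) simp_all
      ultimately have "k \<le> 16" by (elim insertE emptyE) simp_all
      then show ?thesis using 3 assms(3) by simp
    qed
  qed
qed

section \<open>Bounding the class number\<close>

lemma (in group) class_number_mult_order:
  assumes "finite (carrier G)"
  shows "class_number G * order G = card {(x, y) \<in> carrier G \<times> carrier G. x \<otimes> y = y \<otimes> x}"
proof -
  let ?\<phi> = "\<lambda>g. \<lambda>h \<in> carrier G. g \<otimes> h \<otimes> inv g"
  interpret conj: group_action G "carrier G" ?\<phi> by (rule action_by_conjugation)
  have inv: "invariants (carrier G) ?\<phi> x = {y \<in> carrier G. x \<otimes> y = y \<otimes> x}" if x: "x \<in> carrier G" for x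
  proof -
    have "x \<otimes> y \<otimes> inv x = y \<longleftrightarrow> x \<otimes> y = y \<otimes> x" if "y \<in> carrier G" for y
      using x that by (metis inv_solve_right m_closed)
    then show ?thesis by (auto simp: invariants_def)
  qed
  have "class_number G * order G = (\<Sum>x\<in>carrier G. card (invariants (carrier G) ?\<phi> x))"
    unfolding class_number_def by (rule conj.burnside[OF assms assms])
  also have "\<dots> = card (SIGMA x:carrier G. {y \<in> carrier G. x \<otimes> y = y \<otimes> x})"
    using assms by (subst card_SigmaI) (simp_all add: inv)
  also have "(SIGMA x:carrier G. {y \<in> carrier G. x \<otimes> y = y \<otimes> x})
      = {(x, y) \<in> carrier G \<times> carrier G. x \<otimes> y = y \<otimes> x}" by auto
  finally show ?thesis .
qed

context semilinear_subgroup
begin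

lemma affine_product_simps:
  "carrier (affine_product R G) = V \<times> G"
  "(v, g) \<otimes>\<^bsub>affine_product R G\<^esub> (w, h) = (v \<oplus> g w, g \<otimes>\<^bsub>semilinear_group R\<^esub> h)"
  "\<one>\<^bsub>affine_product R G\<^esub> = (\<zero>, ident)"
  by (simp_all add: affine_product_def semidirect_product_def one_eq_id)

lemma order_affine_product: "order (affine_product R G) = card V * (card aut_parts * card scalars)"
  by (simp add: order_def affine_product_simps card_cartesian_product card_G)

lemma commuting_iff:
  assumes "g \<in> G" "h \<in> G"
  shows "g \<otimes>\<^bsub>semilinear_group R\<^esub> h = h \<otimes>\<^bsub>semilinear_group R\<^esub> g \<longleftrightarrow> commuting g h"
proof -
  have "compose V g h = compose V h g \<longleftrightarrow> (\<forall>x\<in>V. g (h x) = h (g x))"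
  proof
    assume eq: "compose V g h = compose V h g"
    show "\<forall>x\<in>V. g (h x) = h (g x)"
    proof
      fix x assume "x \<in> V"
      then show "g (h x) = h (g x)" using fun_cong[OF eq, of x] by (simp add: compose_eq)
    qed
  qed (auto simp: compose_def intro!: restrict_ext)
  then show ?thesis using assms by (simp add: mult_eq_compose commuting_def)
qed

text \<open>
  The product of \<open>(v, g)\<close> and \<open>(w, h)\<close> has the components \<open>v + g w\<close> and \<open>g h\<close>.
\<close>

lemma card_commuting_pairs:
  "card {(x, y) \<in> carrier (affine_product R G) \<times> carrier (affine_product R G).
     x \<otimes>\<^bsub>affine_product R G\<^esub> y = y \<otimes>\<^bsub>affine_product R G\<^esub> x} = total_pairs" (is "card ?P = _")
proof -
  let ?M = "\<lambda>g h. {(v, w) \<in> V \<times> V. v \<oplus> g w = w \<oplus> h v}"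
  let ?S = "SIGMA g:G. SIGMA h:{h \<in> G. commuting g h}. ?M g h"
  have "bij_betw (\<lambda>((v, g), (w, h)). (g, h, v, w)) ?P ?S"
    by (rule bij_betw_byWitness[where f' = "\<lambda>(g, h, v, w). ((v, g), (w, h))"])
       (auto simp: affine_product_simps commuting_iff)
  then have "card ?P = card ?S" by (rule bij_betw_same_card)
  also have "\<dots> = total_pairs"
  proof -
    have "finite (?M g h)" for g h by (rule finite_subset[of _ "V \<times> V"]) (use fin in auto)
    then show ?thesis
      using finite_G by (simp add: total_pairs_def pair_count_def card_SigmaI finite_SigmaI del: mem_Collect_eq)
  qed
  finally show ?thesis .
qed

lemma class_number_affine_product_le:
  "class_number (affine_product R G) * card aut_parts * card scalars
    \<le> card scalars ^ 2 + (card V - 1) + (card aut_parts + 1) *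
      (\<Sum>s\<in>aut_parts - {ident}. card scalars * min (card scalars) (card (nonzero_fixed s)) + min (card scalars * card (nonzero_fixed s)) (card V - 1))"
proof -
  interpret H: group "affine_product R G" by (rule group_affine_product[OF field_axioms sub])
  have "finite (carrier (affine_product R G))" using fin finite_G by (simp add: affine_product_simps)
  then have "card V * (class_number (affine_product R G) * card aut_parts * card scalars) = total_pairs"
    using H.class_number_mult_order card_commuting_pairs
    by (simp add: order_affine_product mult.assoc mult.left_commute)
  also note total_pairs_le
  finally have le: "card V * (class_number (affine_product R G) * card aut_parts * card scalars) \<le> card V *
    (card scalars ^ 2 + (card V - 1) + (card aut_parts + 1) *
      (\<Sum>s\<in>aut_parts - {ident}. card scalars * min (card scalars) (card (nonzero_fixed s)) + min (card scalars * card (nonzero_fixed s)) (card V - 1)))" .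
  have "0 < card V" using fin zero_closed by (auto simp: card_gt_0_iff)
  then show ?thesis using le by (simp only: nat_mult_le_cancel1)
qed

lemma card_scalars_bounds: "1 \<le> card scalars" "card scalars \<le> card V - 1"
proof -
  show "1 \<le> card scalars" using one_in_scalars finite_sets(1) by (metis One_nat_def Suc_leI card_gt_0_iff empty_iff)
  have "card scalars \<le> card (V - {\<zero>})" using fin by (intro card_mono) (auto simp: scalars_def)
  then show "card scalars \<le> card V - 1" using fin by simp
qed

lemma class_number_le_or_exceptional:
  assumes p: "Factorial_Ring.prime p" and card: "card V = p ^ n"
  shows "class_number (affine_product R G) \<le> card V
    \<or> (card V = 4 \<and> card aut_parts = 2 \<and> (card scalars = 1 \<or> card scalars = 3))"
proof -
  have parts: "aut_parts \<subseteq> field_auts R" "aut_parts \<noteq> {}" using G_form(1) id_in_G by auto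
  have closed: "compose V s t \<in> aut_parts" if st: "s \<in> aut_parts" "t \<in> aut_parts" for s t
  proof -
    obtain g h where "g \<in> G" "h \<in> G" "s = \<alpha> g" "t = \<alpha> h" using st by blast
    then have "compose V s t = \<alpha> (compose V g h)" "compose V g h \<in> G"
      by (simp_all add: aut_part_compose compose_in_G)
    then show ?thesis by blast
  qed
  obtain r \<psi> where r: "2 \<le> r" "r ^ card aut_parts = card V" "1 \<le> card aut_parts"
    and \<psi>: "bij_betw \<psi> {..<card aut_parts} aut_parts" "\<psi> 0 = ident"
    and fixed: "\<forall>i\<in>{1..<card aut_parts}.
      card {x \<in> V - {\<zero>}. \<psi> i x = x} \<le> r ^ min i (card aut_parts - i) - 1"
    by (rule automorphism_group_cyclic[OF p card fin parts closed])
  define d where "d = card aut_parts"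
  define m where "m = card scalars"
  define q where "q = card V"
  define k where "k = class_number (affine_product R G)"
  let ?y = "\<lambda>i. r ^ min i (d - i) - 1"
  have "{..<d} - {0} = {1..<d}" "{1..<d} \<subseteq> {..<d}" by auto
  then have "\<psi> ` {1..<d} = \<psi> ` {..<d} - \<psi> ` {0}"
    using \<psi>(1) r(3) inj_on_image_set_diff[of \<psi> "{..<d}" "{..<d}" "{0}"]
    by (simp add: bij_betw_def d_def)
  then have img: "aut_parts - {ident} = \<psi> ` {1..<d}" using \<psi> by (simp add: bij_betw_def d_def)
  have inj: "inj_on \<psi> {1..<d}"
    using \<psi>(1) by (rule inj_on_subset[OF bij_betw_imp_inj_on]) (auto simp: d_def)
  have "(\<Sum>s\<in>aut_parts - {ident}. m * min m (card (nonzero_fixed s)) + min (m * card (nonzero_fixed s)) (q - 1))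
      = (\<Sum>i\<in>{1..<d}. m * min m (card (nonzero_fixed (\<psi> i))) + min (m * card (nonzero_fixed (\<psi> i))) (q - 1))"
    unfolding img using inj by (simp add: sum.reindex)
  also have "\<dots> \<le> (\<Sum>i\<in>{1..<d}. m * min m (?y i) + min (m * ?y i) (q - 1))"
  proof (rule sum_mono)
    fix i assume "i \<in> {1..<d}"
    then have "card (nonzero_fixed (\<psi> i)) \<le> ?y i" using fixed by (simp add: nonzero_fixed_def d_def)
    then show "m * min m (card (nonzero_fixed (\<psi> i))) + min (m * card (nonzero_fixed (\<psi> i))) (q - 1)
        \<le> m * min m (?y i) + min (m * ?y i) (q - 1)"
      by (intro add_mono mult_le_mono2 min.mono) simp_all
  qed
  finally have bound: "k * d * m \<le> m ^ 2 + (q - 1) + (d + 1) *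
      (\<Sum>i\<in>{1..<d}. m * min m (?y i) + min (m * ?y i) (q - 1))"
    using class_number_affine_product_le unfolding k_def d_def m_def q_def
    by (meson add_left_mono le_trans mult_le_mono2)
  have m: "1 \<le> m" "m \<le> q - 1" using card_scalars_bounds by (simp_all add: m_def q_def)
  show ?thesis
  proof (cases "r = 2 \<and> d = 2")
    case False
    have "k \<le> q"
      by (rule class_number_arithmetic[OF bound _ r(1) _ m False]) (use r in \<open>simp_all add: q_def d_def\<close>)
    then show ?thesis by (simp add: k_def q_def)
  next
    case True
    then have q4: "q = 4" using r(2) by (simp add: q_def d_def)
    show ?thesis
    proof (cases "m = 2")
      case True
      \<comment> \<open>The only nontrivial automorphism fixes one nonzero element: \<open>4 * k \<le> 4 + 3 + 3 * (2 + 2)\<close>.\<close>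
      have "{1..<2::nat} = {1}" by auto
      then have "k \<le> 4" using bound True \<open>r = 2 \<and> d = 2\<close> q4 by simp
      then show ?thesis using q4 by (simp add: k_def q_def)
    next
      case False
      then have "m = 1 \<or> m = 3" using m q4 by auto
      then show ?thesis using q4 True by (simp add: q_def d_def m_def)
    qed
  qed
qed

end

section \<open>The exceptional groups of orders 8 and 24\<close>

text \<open>
  The isomorphism from the dihedral group sends \<open>(k, e)\<close> to \<open>s ^ k\<close>, times \<open>t\<close> if \<open>e = - 1\<close>.
\<close>

lemma (in group) iso_dihedral_group:
  assumes s: "s \<in> carrier G" and t: "t \<in> carrier G" and n: "ord s = n" "0 < n"
    and card: "card (carrier G) = 2 * n"
    and notin: "t \<notin> (\<lambda>k. s [^] k) ` {..<n}" and tt: "t \<otimes> t = \<one>" and conj: "t \<otimes> s \<otimes> t = inv s"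
  shows "G \<cong> dihedral_group n"
proof -
  define f :: "int \<times> int \<Rightarrow> 'a" where "f = (\<lambda>(k, e). s [^] k \<otimes> (if e = 1 then \<one> else t))"
  have sn: "s [^] int n = \<one>" using pow_ord_eq_1[OF s] n(1) by (simp add: int_pow_int)
  have mod: "s [^] (j mod int n) = s [^] j" for j :: int
  proof -
    have "s [^] j = s [^] (int n * (j div int n) + j mod int n)" by simp
    also have "\<dots> = s [^] (int n * (j div int n)) \<otimes> s [^] (j mod int n)"
      using s by (rule int_pow_mult)
    also have "s [^] (int n * (j div int n)) = (s [^] int n) [^] (j div int n)"
      using s by (simp add: int_pow_pow)
    finally show ?thesis using s by (simp add: sn)
  qed
  have c_hom: "group_hom G G (\<lambda>x. t \<otimes> x \<otimes> t)"
  proof unfold_locales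
    have "t \<otimes> (x \<otimes> y) \<otimes> t = (t \<otimes> x \<otimes> t) \<otimes> (t \<otimes> y \<otimes> t)" if "x \<in> carrier G" "y \<in> carrier G" for x y
    proof -
      have "(t \<otimes> x \<otimes> t) \<otimes> (t \<otimes> y \<otimes> t) = t \<otimes> x \<otimes> (t \<otimes> t) \<otimes> y \<otimes> t"
        using that t by (simp add: m_assoc del: tt)
      then show ?thesis using that t by (simp add: tt m_assoc)
    qed
    then show "(\<lambda>x. t \<otimes> x \<otimes> t) \<in> hom G G" using t by (simp add: hom_def Pi_iff)
  qed
  have flip: "t \<otimes> s [^] k = s [^] (- k) \<otimes> t" for k :: int
  proof -
    have "t \<otimes> s [^] k \<otimes> t = s [^] (- k)"
      using group_hom.hom_int_pow[OF c_hom s, of k] s by (simp add: conj int_pow_inv int_pow_neg)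
    then have "(t \<otimes> s [^] k \<otimes> t) \<otimes> t = s [^] (- k) \<otimes> t" by simp
    then show ?thesis using s t by (simp add: m_assoc tt)
  qed
  have hom: "f \<in> hom (dihedral_group n) G"
  proof (rule homI)
    fix x y assume x: "x \<in> carrier (dihedral_group n)" and y: "y \<in> carrier (dihedral_group n)"
    obtain k e where xe: "x = (k, e)" "e = 1 \<or> e = - 1"
      using x by (cases x) (auto simp: dihedral_group_def semidirect_product_def sign_img_def)
    obtain l e' where ye: "y = (l, e')" "e' = 1 \<or> e' = - 1"
      using y by (cases y) (auto simp: dihedral_group_def semidirect_product_def sign_img_def)
    have prod: "x \<otimes>\<^bsub>dihedral_group n\<^esub> y = ((k + e * l) mod int n, e * e')"
      by (simp add: xe ye dihedral_group_def semidirect_product_def sign_img_def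
          mult_integer_mod_group mod_simps)
    have "f (x \<otimes>\<^bsub>dihedral_group n\<^esub> y) = s [^] (k + e * l) \<otimes> (if e * e' = 1 then \<one> else t)"
      by (simp add: prod f_def mod)
    also have "\<dots> = s [^] k \<otimes> s [^] (e * l) \<otimes> (if e * e' = 1 then \<one> else t)"
      using s by (simp add: int_pow_mult)
    also have "\<dots> = f x \<otimes> f y"
      using xe(2)
    proof
      assume "e = 1"
      then show ?thesis using s t by (simp add: f_def xe ye m_assoc)
    next
      assume e: "e = - 1"
      have "f x \<otimes> f y = s [^] k \<otimes> (t \<otimes> s [^] l) \<otimes> (if e' = 1 then \<one> else t)"
        using s t by (simp add: f_def xe(1) ye(1) e m_assoc)
      also have "\<dots> = s [^] k \<otimes> s [^] (- l) \<otimes> (t \<otimes> (if e' = 1 then \<one> else t))"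
        unfolding flip using s t by (simp add: m_assoc)
      also have "t \<otimes> (if e' = 1 then \<one> else t) = (if e * e' = 1 then \<one> else t)"
        using ye(2) e t tt by auto
      finally show ?thesis by (simp add: e)
    qed
    finally show "f (x \<otimes>\<^bsub>dihedral_group n\<^esub> y) = f x \<otimes> f y" .
  qed (use s t in \<open>auto simp: f_def\<close>)
  have inj: "inj_on f (carrier (dihedral_group n))"
  proof (rule inj_onI)
    fix x y assume x: "x \<in> carrier (dihedral_group n)" and y: "y \<in> carrier (dihedral_group n)"
      and eq: "f x = f y"
    obtain k e where xe: "x = (k, e)" "e = 1 \<or> e = - 1" "0 \<le> k" "k < int n"
      using x n(2) by (cases x)
        (auto simp: dihedral_group_def semidirect_product_def sign_img_def carrier_integer_mod_group)
    obtain l e' where ye: "y = (l, e')" "e' = 1 \<or> e' = - 1" "0 \<le> l" "l < int n"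
      using y n(2) by (cases y)
        (auto simp: dihedral_group_def semidirect_product_def sign_img_def carrier_integer_mod_group)
    have no: "s [^] i \<noteq> s [^] j \<otimes> t" for i j :: int
    proof
      assume "s [^] i = s [^] j \<otimes> t"
      then have "s [^] (- j) \<otimes> s [^] i = s [^] (- j) \<otimes> (s [^] j \<otimes> t)" by simp
      also have "\<dots> = t" using s t by (simp add: m_assoc[symmetric] int_pow_mult[symmetric])
      finally have "t = s [^] (i - j)" using s by (simp add: int_pow_mult[symmetric])
      then have "t = s [^] ((i - j) mod int n)" by (simp add: mod)
      also have "\<dots> = s [^] nat ((i - j) mod int n)" using n(2) by (simp add: int_pow_int[symmetric])
      finally have "t = s [^] nat ((i - j) mod int n)" .
      moreover have "nat ((i - j) mod int n) < n" using n(2) by (simp add: nat_less_iff)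
      ultimately show False using notin by blast
    qed
    have ee: "e = e'"
      using eq no[of k l] no[of l k] xe(2) ye(2) s t by (auto simp: f_def xe(1) ye(1))
    then have "s [^] k = s [^] l"
      using eq s t by (auto simp: f_def xe(1) ye(1) split: if_splits)
    then have "s [^] nat k = s [^] nat l" using xe(3) ye(3) by (simp add: int_pow_int[symmetric])
    moreover have "nat k \<in> {0..ord s - 1}" "nat l \<in> {0..ord s - 1}"
      using xe ye n by auto
    ultimately have "nat k = nat l" using inj_onD[OF ord_inj[OF s]] by blast
    then show "x = y" using xe ye ee by simp
  qed
  have fin: "finite (carrier G)" using card n(2) by (simp add: card_ge_0_finite)
  have sub: "f ` carrier (dihedral_group n) \<subseteq> carrier G" using hom by (auto simp: hom_def)
  have "card (f ` carrier (dihedral_group n)) = card (carrier G)"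
    using card_image[OF inj] by (simp add: card_dihedral_group card)
  then have "f ` carrier (dihedral_group n) = carrier G" using card_subset_eq[OF fin sub] by simp
  then have "f \<in> iso (dihedral_group n) G" using hom inj by (simp add: iso_def bij_betw_def)
  then have "dihedral_group n \<cong> G" by (auto simp: is_iso_def)
  then show ?thesis by (rule group.iso_sym[OF group_dihedral_group])
qed

context semilinear_subgroup
begin

text \<open>
  The semidirect product acts faithfully on \<open>V\<close> by \<open>x \<mapsto> v + g x\<close>; the hypothesis says that there are as
  many such maps as permutations of \<open>V\<close>.
\<close>

lemma affine_product_iso_sym_group:
  assumes "card (carrier (affine_product R G)) = fact (card V)"
  shows "affine_product R G \<cong> sym_group (card V)"
proof -
  define k where "k = card V"
  define I where "I = {1..k}"
  obtain b where b: "bij_betw b I V"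
    using ex_bij_betw_nat_finite_1[OF fin] by (auto simp: k_def I_def)
  define c where "c = inv_into I b"
  have c: "bij_betw c V I" unfolding c_def by (rule bij_betw_inv_into[OF b])
  have bc: "b (c x) = x" if "x \<in> V" for x unfolding c_def using b that by (rule bij_betw_inv_into_right)
  have bV: "b i \<in> V" if "i \<in> I" for i using b that by (rule bij_betwE[rule_format])
  have cI: "c x \<in> I" if "x \<in> V" for x using c that by (rule bij_betwE[rule_format])
  have c_inj: "x = y" if "x \<in> V" "y \<in> V" "c x = c y" for x y
    using that c by (auto simp: bij_betw_def dest: inj_onD)
  define f where "f = (\<lambda>(v, g) i. if i \<in> I then c (v \<oplus> g (b i)) else i)"
  have perm: "f (v, g) permutes I" if v: "v \<in> V" and g: "g \<in> G" for v g
  proof (rule bij_imp_permutes)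
    have "inj_on (f (v, g)) I"
    proof (rule inj_onI)
      fix i j assume ij: "i \<in> I" "j \<in> I" "f (v, g) i = f (v, g) j"
      have gb: "g (b i) \<in> V" "g (b j) \<in> V" using ij bV G_closed[OF g] by simp_all
      then have "v \<oplus> g (b i) = v \<oplus> g (b j)" using ij v by (intro c_inj) (simp_all add: f_def)
      then have "g (b i) = g (b j)" using v gb by simp
      then have "b i = b j" using G_inj[OF g] bV ij by simp
      then show "i = j" using b ij by (auto simp: bij_betw_def dest: inj_onD)
    qed
    moreover have "f (v, g) ` I \<subseteq> I" using v bV G_closed[OF g] cI by (auto simp: f_def)
    moreover have "finite I" by (simp add: I_def)
    ultimately show "bij_betw (f (v, g)) I I" using endo_inj_surj unfolding bij_betw_def by blast
  qed (auto simp: f_def)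
  have hom: "f \<in> hom (affine_product R G) (sym_group k)"
  proof (rule homI)
    fix x assume "x \<in> carrier (affine_product R G)"
    then show "f x \<in> carrier (sym_group k)"
      using perm by (cases x) (simp add: affine_product_simps sym_group_carrier I_def)
  next
    fix x y assume "x \<in> carrier (affine_product R G)" "y \<in> carrier (affine_product R G)"
    then obtain v g w h where xy: "x = (v, g)" "y = (w, h)" "v \<in> V" "w \<in> V" "g \<in> G" "h \<in> G"
      by (cases x; cases y) (auto simp: affine_product_simps)
    have "f (x \<otimes>\<^bsub>affine_product R G\<^esub> y) i = f x (f y i)" for i
    proof (cases "i \<in> I")
      case True
      have hb: "h (b i) \<in> V" "w \<oplus> h (b i) \<in> V" using True bV G_closed xy by simp_all
      have "(v \<oplus> g w) \<oplus> g (h (b i)) = v \<oplus> g (w \<oplus> h (b i))"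
        using xy hb G_closed[OF xy(5)] by (simp add: G_add a_assoc)
      then show ?thesis
        using True cI[OF hb(2)] bc[OF hb(2)] bV[OF True] xy
        by (simp add: f_def affine_product_simps mult_eq_compose compose_eq)
    qed (simp add: f_def xy affine_product_simps)
    then show "f (x \<otimes>\<^bsub>affine_product R G\<^esub> y) = f x \<otimes>\<^bsub>sym_group k\<^esub> f y"
      by (auto simp: sym_group_mult)
  qed
  have inj: "inj_on f (carrier (affine_product R G))"
  proof (rule inj_onI)
    fix x y assume "x \<in> carrier (affine_product R G)" "y \<in> carrier (affine_product R G)"
      and eq: "f x = f y"
    then obtain v g w h where xy: "x = (v, g)" "y = (w, h)" "v \<in> V" "w \<in> V" "g \<in> G" "h \<in> G"
      by (cases x; cases y) (auto simp: affine_product_simps)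
    have pt: "v \<oplus> g z = w \<oplus> h z" if z: "z \<in> V" for z
    proof -
      have "f x (c z) = f y (c z)" by (simp add: eq)
      then have "c (v \<oplus> g z) = c (w \<oplus> h z)"
        using cI[OF z] bc[OF z] by (simp add: f_def xy)
      then show ?thesis using xy G_closed z by (intro c_inj) simp_all
    qed
    have vw: "v = w" using pt[OF zero_closed] xy by (simp add: G_zero)
    have "g z = h z" if z: "z \<in> V" for z
      using pt[OF z] vw xy G_closed z by simp
    then have "g = h" using xy by (intro G_ext)
    then show "x = y" using xy vw by simp
  qed
  have cards: "card (carrier (sym_group k)) = fact k"
    using card_permutations[of I k] by (simp add: sym_group_def I_def)
  then have fin': "finite (carrier (sym_group k))" by (simp add: card_ge_0_finite)
  have "card (f ` carrier (affine_product R G)) = card (carrier (sym_group k))"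
    using card_image[OF inj] assms cards by (simp add: k_def)
  moreover have "f ` carrier (affine_product R G) \<subseteq> carrier (sym_group k)"
    using hom by (auto simp: hom_def)
  ultimately have "f ` carrier (affine_product R G) = carrier (sym_group k)"
    using card_subset_eq[OF fin'] by blast
  then have "f \<in> iso (affine_product R G) (sym_group k)" using hom inj by (simp add: iso_def bij_betw_def)
  then show ?thesis unfolding k_def[symmetric] by (auto simp: is_iso_def)
qed

text \<open>
  The nontrivial element \<open>g\<close> of \<open>G\<close> is an involution, and the field has characteristic 2. For a vector
  \<open>v\<close> that \<open>g\<close> moves, \<open>(v, g)\<close> has order 4, because its square is the nonzero translation by \<open>v + g v\<close>.
  The involution \<open>(0, g)\<close> inverts it.
\<close>

lemma affine_product_iso_dihedral_group:
  assumes V4: "card V = 4" and G2: "card G = 2"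
  shows "affine_product R G \<cong> dihedral_group 4"
proof -
  interpret H: group "affine_product R G" by (rule group_affine_product[OF field_axioms sub])
  let ?H = "affine_product R G"
  have "add_pow R (2::nat) \<one> = \<zero>"
    using V4 by (intro char_of_prime_power_card[of 2 2] fin) simp_all
  then have "add_pow R (2::nat) x = \<zero>" if "x \<in> V" for x
    using that add_pow_eq_zero[of 2 2 x] by simp
  then have double: "x \<oplus> x = \<zero>" if "x \<in> V" for x
    using that by (simp add: numeral_2_eq_2)
  obtain g where g: "g \<in> G" "g \<noteq> ident"
    using G2 by (metis card_2_iff insert_iff)
  have G: "G = {ident, g}"
    using card_seteq[OF finite_G, of "{ident, g}"] G2 g id_in_G by auto
  have gg: "g (g x) = x" if x: "x \<in> V" for x
  proof -
    \<comment> \<open>\<open>G\<close> has just two elements, so the square of \<open>g\<close> is \<open>g\<close> or the identity.\<close>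
    have "compose V g g \<noteq> g"
    proof
      assume eq: "compose V g g = g"
      have "g y = ident y" if y: "y \<in> V" for y
      proof -
        have "g (g y) = g y" using fun_cong[OF eq, of y] y by (simp add: compose_eq)
        then show ?thesis using G_inj[OF g(1) G_closed[OF g(1) y] y] y by simp
      qed
      then show False using g G_ext[OF g(1) id_in_G] by blast
    qed
    then have "compose V g g = ident" using compose_in_G[OF g(1) g(1)] G by blast
    then show ?thesis using x by (metis compose_eq restrict_apply')
  qed
  have ggc: "compose V g g = ident" unfolding compose_def by (intro restrict_ext) (simp add: gg)
  have gid: "compose V ident g = g" "compose V g ident = g"
    by (intro G_ext compose_in_G id_in_G g(1); simp add: compose_eq G_closed[OF g(1)] id_in_G)+
  obtain v where v: "v \<in> V" "g v \<noteq> v"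
    using g G_ext[OF g(1) id_in_G] by auto
  have gv: "g v \<in> V" using g(1) v(1) by (rule G_closed)
  have v0: "v \<noteq> \<zero>" "g v \<noteq> \<zero>" using v G_zero[OF g(1)] G_inj[OF g(1) v(1) zero_closed] by auto
  define w where "w = v \<oplus> g v"
  have w: "w \<in> V" "w \<noteq> \<zero>"
  proof -
    show "w \<noteq> \<zero>"
    proof
      assume "w = \<zero>"
      then have "v \<oplus> g v = v \<oplus> v" using double v(1) by (simp add: w_def)
      then show False using v gv by simp
    qed
  qed (use v gv in \<open>simp add: w_def\<close>)
  note mult = affine_product_simps(2) mult_eq_compose
  let ?s = "(v, g)" and ?t = "(\<zero>, g)"
  have st: "?s \<in> carrier ?H" "?t \<in> carrier ?H" using v(1) g(1) by (simp_all add: affine_product_simps(1))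
  have s2: "?s \<otimes>\<^bsub>?H\<^esub> ?s = (w, ident)" using g(1) by (simp add: mult ggc w_def)
  have s4: "(w, ident) \<otimes>\<^bsub>?H\<^esub> (w, ident) = \<one>\<^bsub>?H\<^esub>"
    using w double id_in_G by (simp add: mult affine_product_simps(3))
  have wv: "w \<oplus> v = g v"
  proof -
    have "w \<oplus> v = g v \<oplus> (v \<oplus> v)" unfolding w_def using v(1) gv by algebra
    then show ?thesis using double[OF v(1)] gv by simp
  qed
  have s3: "(w, ident) \<otimes>\<^bsub>?H\<^esub> ?s = (g v, g)"
    using g(1) id_in_G v(1) wv by (simp add: mult gid)
  have p0: "?s [^]\<^bsub>?H\<^esub> (0::nat) = \<one>\<^bsub>?H\<^esub>" by simp
  have p1: "?s [^]\<^bsub>?H\<^esub> (1::nat) = ?s" using st by simp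
  have p2: "?s [^]\<^bsub>?H\<^esub> (2::nat) = (w, ident)" using st s2 by (simp add: numeral_2_eq_2)
  have p3: "?s [^]\<^bsub>?H\<^esub> (3::nat) = (g v, g)"
    using H.nat_pow_mult[OF st(1), of 2 1] p1 p2 s3 by simp
  have p4: "?s [^]\<^bsub>?H\<^esub> (4::nat) = \<one>\<^bsub>?H\<^esub>"
    using H.nat_pow_mult[OF st(1), of 2 2] p2 s4 by simp
  have "H.ord ?s dvd 4" using H.pow_eq_id[OF st(1)] p4 by simp
  moreover have "\<not> H.ord ?s dvd 2"
    using H.pow_eq_id[OF st(1), of 2, symmetric] p2 w(2) by (simp add: affine_product_simps(3))
  ultimately have ord: "H.ord ?s = 4"
  proof -
    assume d: "H.ord ?s dvd 4" "\<not> H.ord ?s dvd 2"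
    then have "H.ord ?s \<in> {..4}" by (auto dest: dvd_imp_le)
    then have "H.ord ?s \<in> {0,1,2,3,4}" by (auto simp: atMost_nat_numeral)
    then show ?thesis using d by auto
  qed
  show ?thesis
  proof (rule H.iso_dihedral_group[OF st ord])
    show "card (carrier ?H) = 2 * 4"
      by (simp add: affine_product_simps(1) card_cartesian_product V4 G2)
    show "?t \<notin> (\<lambda>k. ?s [^]\<^bsub>?H\<^esub> k) ` {..<4::nat}"
    proof
      assume "?t \<in> (\<lambda>k. ?s [^]\<^bsub>?H\<^esub> k) ` {..<4::nat}"
      then obtain k where k: "k < (4::nat)" "?t = ?s [^]\<^bsub>?H\<^esub> k" by auto
      then have "k \<in> {0, 1, 2, 3}" by auto
      then show False using k(2) p0 p1 p2 p3 g(2) v0 by (auto simp: affine_product_simps(3))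
    qed
    show "?t \<otimes>\<^bsub>?H\<^esub> ?t = \<one>\<^bsub>?H\<^esub>"
      using g(1) G_zero[OF g(1)] by (simp add: mult ggc affine_product_simps(3))
    have ts: "?t \<otimes>\<^bsub>?H\<^esub> ?s \<otimes>\<^bsub>?H\<^esub> ?t = (g v, g)"
      using g(1) id_in_G gv v(1) by (simp add: mult ggc gid)
    have "(g v, g) \<otimes>\<^bsub>?H\<^esub> ?s = \<one>\<^bsub>?H\<^esub>"
      using g(1) double[OF gv] by (simp add: mult ggc affine_product_simps(3))
    then have "inv\<^bsub>?H\<^esub> ?s = (g v, g)"
      using st(1) gv g(1) by (intro H.inv_equality) (simp_all add: affine_product_simps(1))
    then show "?t \<otimes>\<^bsub>?H\<^esub> ?s \<otimes>\<^bsub>?H\<^esub> ?t = inv\<^bsub>?H\<^esub> ?s" using ts by simp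
  qed simp
qed

end

theorem theorem1p2:
  fixes F :: "('a, 'm) ring_scheme" and p n :: nat and G :: "('a \<Rightarrow> 'a) set"
  assumes "Factorial_Ring.prime p"
    and "field F"
    and "finite (carrier F)"
    and "card (carrier F) = p ^ n"
    and "subgroup G (semilinear_group F)"
  shows "class_number (affine_product F G) \<le> card (carrier F)
         \<or> affine_product F G \<cong> dihedral_group 4
         \<or> affine_product F G \<cong> sym_group 4"
proof -
  interpret semilinear_subgroup F G
    using assms(2,3,5) by (simp add: semilinear_subgroup_def semilinear_subgroup_axioms_def)
  have "affine_product F G \<cong> dihedral_group 4" if "card V = 4" "card aut_parts = 2" "card scalars = 1"
    using that by (intro affine_product_iso_dihedral_group) (simp_all add: card_G)
  moreover have "affine_product F G \<cong> sym_group 4" if "card V = 4" "card aut_parts = 2" "card scalars = 3"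
    using affine_product_iso_sym_group that order_affine_product
    by (simp add: order_def fact_numeral)
  ultimately show ?thesis using class_number_le_or_exceptional[OF assms(1,4)] by blast
qed

end
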